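(* Let $0\le T_1<T_2\le\bar T$ and let $$RO(t,T_1,T_2)=\mathbb E_{\mathbb Q}\left[\left.\int_{T_1}^{T_2}(S_T-\kappa)^+dT\,\right|\mathcal F_t\right]=\int_{T_1}^{T_2}\mathbb E_{\mathbb Q}\left[(S_T-\kappa)^+\mid\mathcal F_t\right]dT$$ be the price of the Reliability Option with fixed strike price $\kappa$ written on the time span $[T_1,T_2]$. Then its price at time $t=0$ is $$RO(0,T_1,T_2)=\int_{T_1}^{T_2}\sigma(0,T,T)\big(d_TN(d_T)+n(d_T)\big)\,dT,$$ with $$\sigma(0,T,T)=\sqrt{\int_0^T|K(T,u)|^2du},\qquad d_T:=\frac{\varphi_{\mathbb Q}(T)-\kappa}{\sigma(0,T,T)},\qquad \varphi_{\mathbb Q}(T)=\varphi(T)-\int_0^TK(T,t)\cdot\theta_t\,dt,$$ where $n(x)=\frac1{\sqrt{2\pi}}e^{-x^2/2}$ and $N(y)=\int_{-\infty}^yn(x)\,dx$.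
   Context: $(\Omega,\mathcal F,\mathbb P)$ is a probability space with the completed filtration $(\mathcal F_t)$ generated by an $n$-dimensional Brownian motion $W$. The spot price is $S_t=\int_0^tK(t,s)\cdot dW_s+\varphi(t)$, $t\in[0,\bar T]$, with $\varphi\in C^0([0,\bar T])$ deterministic and $K:[0,\bar T]^2\to\mathbb R^n$ a deterministic Volterra kernel vector with $\int_0^t|K(t,s)|^2ds<\infty$ for all $t$. The pricing measure $\mathbb Q\sim\mathbb P$ has density process $\exp(-\int_0^t\theta_s\cdot dW_s-\frac12\int_0^t|\theta_s|^2ds)$ with $\theta:[0,\bar T]\to\mathbb R^n$ deterministic and $\int_0^{\bar T}|\theta_s|^2ds<\infty$; thus $S_t=\int_0^tK(t,s)\cdot dW^{\mathbb Q}_s+\varphi_{\mathbb Q}(t)$ with the $\mathbb Q$-Brownian motion $W^{\mathbb Q}_t=W_t+\int_0^t\theta_s\,ds$. The interest rate is $0$. It is understood that $\sigma(0,T,T)>0$ for (almost all) $T\in[T_1,T_2]$, so that $d_T$ is defined. *)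

theory Defs
  imports "HOL-Probability.Probability"
begin

section \<open>Brownian motion and its filtration\<close>

definition past_events :: "'a measure \<Rightarrow> (real \<Rightarrow> 'a \<Rightarrow> 'b::topological_space) \<Rightarrow> real \<Rightarrow> 'a set set" where
  "past_events M W t = {W s -` B \<inter> space M | s B. 0 \<le> s \<and> s \<le> t \<and> B \<in> sets borel}"

definition natural_filtration :: "'a measure \<Rightarrow> (real \<Rightarrow> 'a \<Rightarrow> 'b::topological_space) \<Rightarrow> real \<Rightarrow> 'a measure" where
  "natural_filtration M W t = sigma (space M) (past_events M W t)"

text \<open>
  The null sets adjoined below are those of \<open>M\<close>. If \<open>M\<close> is complete, these include all subsets of
  null events, so this is the usual augmentation; completeness of \<open>M\<close> is not needed as a hypothesis.
\<close>

definition completed_filtration :: "'a measure \<Rightarrow> (real \<Rightarrow> 'a \<Rightarrow> 'b::topological_space) \<Rightarrow> real \<Rightarrow> 'a measure" where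
  "completed_filtration M W t = sigma (space M) (past_events M W t \<union> null_sets M)"

definition brownian_motion_on :: "'a measure \<Rightarrow> real \<Rightarrow> (real \<Rightarrow> 'a \<Rightarrow> real ^ 'n) \<Rightarrow> bool" where
  "brownian_motion_on M T W \<longleftrightarrow>
     prob_space M \<and>
     (\<forall>t\<in>{0..T}. W t \<in> borel_measurable M) \<and>
     (AE \<omega> in M. W 0 \<omega> = 0) \<and>
     (AE \<omega> in M. continuous_on {0..T} (\<lambda>t. W t \<omega>)) \<and>
     (\<forall>s t. 0 \<le> s \<and> s < t \<and> t \<le> T \<longrightarrow>
        distributed M lborel (\<lambda>\<omega>. W t \<omega> - W s \<omega>)
          (\<lambda>x. ennreal (\<Prod>i\<in>UNIV. normal_density 0 (sqrt (t - s)) (x $ i))) \<and>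
        prob_space.indep_set M (sets (natural_filtration M W s))
          {(\<lambda>\<omega>. W t \<omega> - W s \<omega>) -` B \<inter> space M | B. B \<in> sets borel})"

section \<open>Stochastic integrals of deterministic integrands\<close>

definition square_integrable_on :: "real set \<Rightarrow> (real \<Rightarrow> 'v::euclidean_space) \<Rightarrow> bool" where
  "square_integrable_on A f \<longleftrightarrow>
     set_borel_measurable lborel A f \<and> set_integrable lborel A (\<lambda>s. (norm (f s))\<^sup>2)"

text \<open>A step function on \<open>{0..t}\<close> is a list of triples \<open>(a, b, c)\<close>, each contributing the value \<open>c\<close>
  on \<open>{a<..b}\<close>.\<close>

definition step_function :: "(real \<times> real \<times> 'v::euclidean_space) list \<Rightarrow> real \<Rightarrow> 'v" where
  "step_function ps s = (\<Sum>(a, b, c)\<leftarrow>ps. indicator {a<..b} s *\<^sub>R c)"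

definition step_integral ::
    "(real \<Rightarrow> 'a \<Rightarrow> 'v::euclidean_space) \<Rightarrow> (real \<times> real \<times> 'v) list \<Rightarrow> 'a \<Rightarrow> real" where
  "step_integral W ps \<omega> = (\<Sum>(a, b, c)\<leftarrow>ps. c \<bullet> (W b \<omega> - W a \<omega>))"

text \<open>\<open>X\<close> is a version of the integral of \<open>f\<close> over \<open>{0..t}\<close> against \<open>W\<close>: the mean-square limit of
  the integrals of step functions that converge to \<open>f\<close> in mean square. It is unique up to null sets.\<close>

definition has_wiener_integral ::
    "'a measure \<Rightarrow> (real \<Rightarrow> 'a \<Rightarrow> 'v::euclidean_space) \<Rightarrow> real \<Rightarrow> (real \<Rightarrow> 'v) \<Rightarrow> ('a \<Rightarrow> real) \<Rightarrow> bool" where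
  "has_wiener_integral M W t f X \<longleftrightarrow>
     X \<in> borel_measurable M \<and>
     (\<exists>ps. (\<forall>k. \<forall>(a, b, c)\<in>set (ps k). 0 \<le> a \<and> a \<le> b \<and> b \<le> t) \<and>
           (\<lambda>k. \<integral>\<^sup>+s\<in>{0..t}. ennreal ((norm (f s - step_function (ps k) s))\<^sup>2) \<partial>lborel) \<longlonglongrightarrow> 0 \<and>
           (\<lambda>k. \<integral>\<^sup>+\<omega>. ennreal ((X \<omega> - step_integral W (ps k) \<omega>)\<^sup>2) \<partial>M) \<longlonglongrightarrow> 0)"

section \<open>Change of measure\<close>

definition equivalent_measures :: "'a measure \<Rightarrow> 'a measure \<Rightarrow> bool" where
  "equivalent_measures M Q \<longleftrightarrow> sets Q = sets M \<and> null_sets Q = null_sets M"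

text \<open>\<open>Q\<close> has density \<open>Z t\<close> with respect to \<open>M\<close> on each \<open>F t\<close>; nothing more is prescribed about \<open>Q\<close>
  outside \<open>F T\<close>.\<close>

definition density_process_on ::
    "'a measure \<Rightarrow> (real \<Rightarrow> 'a measure) \<Rightarrow> real \<Rightarrow> 'a measure \<Rightarrow> (real \<Rightarrow> 'a \<Rightarrow> real) \<Rightarrow> bool" where
  "density_process_on M F T Q Z \<longleftrightarrow>
     (\<forall>t\<in>{0..T}. \<forall>A\<in>sets (F t). emeasure Q A = (\<integral>\<^sup>+\<omega>\<in>A. ennreal (Z t \<omega>) \<partial>M))"

section \<open>Reliability options\<close>

definition call_payoff :: "(real \<Rightarrow> 'a \<Rightarrow> real) \<Rightarrow> real \<Rightarrow> real \<Rightarrow> 'a \<Rightarrow> real" where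
  "call_payoff S \<kappa> T \<omega> = max 0 (S T \<omega> - \<kappa>)"

text \<open>The payoff is nonnegative but its expectation may be infinite, so the price takes values
  in \<open>[0, \<infinity>]\<close>.\<close>

definition reliability_option ::
    "'a measure \<Rightarrow> (real \<Rightarrow> 'a measure) \<Rightarrow> (real \<Rightarrow> 'a \<Rightarrow> real) \<Rightarrow> real \<Rightarrow> real \<Rightarrow> real \<Rightarrow> real \<Rightarrow> 'a \<Rightarrow> ennreal" where
  "reliability_option Q F S \<kappa> T1 T2 t =
     nn_cond_exp Q (F t) (\<lambda>\<omega>. \<integral>\<^sup>+T\<in>{T1..T2}. ennreal (call_payoff S \<kappa> T \<omega>) \<partial>lborel)"

text \<open>Conditional expectations are defined only up to null sets, separately for each \<open>T\<close>. Integrating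
  them over \<open>T\<close> requires a version that is jointly measurable in \<open>(T, \<omega>)\<close>.\<close>

definition cond_call_price_version ::
    "'a measure \<Rightarrow> (real \<Rightarrow> 'a measure) \<Rightarrow> (real \<Rightarrow> 'a \<Rightarrow> real) \<Rightarrow> real \<Rightarrow> real \<Rightarrow> real \<Rightarrow> real
      \<Rightarrow> (real \<Rightarrow> 'a \<Rightarrow> ennreal) \<Rightarrow> bool" where
  "cond_call_price_version Q F S \<kappa> T1 T2 t Y \<longleftrightarrow>
     (\<lambda>(T, \<omega>). Y T \<omega>) \<in> borel_measurable (restrict_space borel {T1..T2} \<Otimes>\<^sub>M F t) \<and>
     (\<forall>T\<in>{T1..T2}. AE \<omega> in Q. Y T \<omega> = nn_cond_exp Q (F t) (\<lambda>\<omega>. ennreal (call_payoff S \<kappa> T \<omega>)) \<omega>)"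

definition std_normal_cdf :: "real \<Rightarrow> real" where
  "std_normal_cdf y = (LINT x:{..y}|lborel. std_normal_density x)"

definition spot_sd :: "(real \<Rightarrow> real \<Rightarrow> real ^ 'n) \<Rightarrow> real \<Rightarrow> real" where
  "spot_sd K T = sqrt (LINT u:{0..T}|lborel. (norm (K T u))\<^sup>2)"

definition spot_mean_Q ::
    "(real \<Rightarrow> real) \<Rightarrow> (real \<Rightarrow> real \<Rightarrow> real ^ 'n) \<Rightarrow> (real \<Rightarrow> real ^ 'n) \<Rightarrow> real \<Rightarrow> real" where
  "spot_mean_Q \<phi> K \<theta> T = \<phi> T - (LINT t:{0..T}|lborel. K T t \<bullet> \<theta> t)"

definition ro_d ::
    "(real \<Rightarrow> real) \<Rightarrow> (real \<Rightarrow> real \<Rightarrow> real ^ 'n) \<Rightarrow> (real \<Rightarrow> real ^ 'n) \<Rightarrow> real \<Rightarrow> real \<Rightarrow> real" where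
  "ro_d \<phi> K \<theta> \<kappa> T = (spot_mean_Q \<phi> K \<theta> T - \<kappa>) / spot_sd K T"

end

theory Submission
  imports Defs "HOL-Real_Asymp.Real_Asymp"
begin

text \<open>A Wiener integral is a mean-square limit of linear combinations of Brownian increments, so its
  characteristic function is \<open>exp (- u\<^sup>2 \<integral>|f|\<^sup>2 / 2)\<close>. By linearity, \<open>X = \<integral> K(T, s) \<bullet> dW\<^sub>s\<close> and
  \<open>I = \<integral> \<theta>\<^sub>s \<bullet> dW\<^sub>s\<close> are jointly Gaussian. Hence \<open>I - a X\<close> is independent of \<open>X\<close> for a suitable \<open>a\<close>, and
  weighting with the density \<open>exp (- I - c)\<close> only tilts the law of \<open>X\<close> by \<open>exp (- a x)\<close>, which shifts its
  mean by \<open>- \<integral> K(T, s) \<bullet> \<theta>\<^sub>s ds\<close>. So the spot price is normal under \<open>Q\<close>, and its call price is an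
  elementary integral. Tonelli's theorem interchanges the integral over \<open>T\<close> with the conditional
  expectations, and conditioning at time \<open>0\<close> is trivial because \<open>W\<^sub>0\<close> is a.s. constant.\<close>

section \<open>Characteristic functions of Gaussian vectors\<close>

text \<open>Characteristic functions suit the purpose because step integrals may be degenerate,
  without a density, and because mean-square convergence passes to characteristic functions. Joint
  normality comes in the Cramer-Wold manner: \<open>u X + v I\<close> is the Wiener integral of
  \<open>u K(T, .) + v \<theta>\<close>, so its variance is a quadratic form in \<open>u\<close> and
  \<open>v\<close> whose mixed coefficient is the covariance, the inner product of the integrands.
  Two obstacles shape the rest. The density of \<open>Q\<close> is prescribed only on
  \<open>F t\<close>, so it determines the law of the spot price only once \<open>X\<close> is known
  to be measurable for \<open>F T\<close>; a mean-square limit is fixed only up to null sets, and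
  the completion of the filtration absorbs these. Moreover, conditional expectations are chosen
  separately for each maturity, so integrating them over \<open>T\<close> presupposes a jointly
  measurable choice, whose existence has to be proved. Prices stay in
  \<open>[0, \<infinity>]\<close>, the natural range for Tonelli's theorem, and the real integral is
  extracted only at the end.\<close>

lemma integral_lborel_prod:
  fixes f :: "'a::euclidean_space \<Rightarrow> real \<Rightarrow> complex"
  assumes f: "\<And>b. b \<in> Basis \<Longrightarrow> integrable lborel (f b)"
  shows "(LINT x|lborel. (\<Prod>b\<in>Basis. f b (x \<bullet> b))) = (\<Prod>b\<in>Basis. (LINT y|lborel. f b y))"
proof -
  interpret product_sigma_finite "\<lambda>b::'a. lborel :: real measure" ..
  have [measurable]: "f b \<in> borel_measurable borel" if "b \<in> Basis" for b
    using borel_measurable_integrable[OF f[OF that]] by simp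
  have "(LINT x|lborel. (\<Prod>b\<in>Basis. f b (x \<bullet> b)))
      = (LINT x|(\<Pi>\<^sub>M b\<in>Basis. lborel). (\<Prod>b\<in>Basis. f b ((\<Sum>b'\<in>Basis. x b' *\<^sub>R b') \<bullet> b)))"
    \<comment> \<open>\<open>lborel_eq\<close> presents Lebesgue measure as the image of a product
      of line measures under the coordinate parametrisation; what remains is Fubini for a product
      integrand.\<close>
    by (subst lborel_eq, subst integral_distr) auto
  also have "\<dots> = (LINT x|(\<Pi>\<^sub>M b\<in>Basis. lborel). (\<Prod>b\<in>Basis. f b (x b)))"
    by (intro Bochner_Integration.integral_cong prod.cong refl) (simp add: inner_sum_left_Basis)
  also have "\<dots> = (\<Prod>b\<in>Basis. (LINT y|lborel. f b y))"
    by (rule product_integral_prod) (auto intro: f)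
  finally show ?thesis .
qed

text \<open>The law is the image of the standard normal law under the affine map with slope \<sigma>
  and shift \<mu>: the shift contributes a phase, the slope rescales the argument.\<close>

lemma char_normal:
  assumes "0 < \<sigma>"
  shows "char (density lborel (normal_density \<mu> \<sigma>)) u = iexp (u * \<mu>) * exp (- (u * \<sigma>)\<^sup>2 / 2)"
proof -
  interpret N: prob_space std_normal_distribution
    by (rule prob_space_normal_density) simp
  have "distributed std_normal_distribution lborel (\<lambda>x. x) std_normal_density"
    by (simp add: distributed_def) (simp add: distr_id2)
  from N.normal_density_affine[OF this _ less_imp_neq[OF assms, symmetric], of \<mu>] assms
  have "distributed std_normal_distribution lborel (\<lambda>x. \<mu> + \<sigma> * x) (normal_density \<mu> \<sigma>)"
    by simp
  then have "density lborel (normal_density \<mu> \<sigma>) = distr std_normal_distribution lborel (\<lambda>x. \<mu> + \<sigma> * x)"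
    by (simp add: distributed_def)
  then have "char (density lborel (normal_density \<mu> \<sigma>)) u
      = (CLINT x|std_normal_distribution. iexp (u * \<mu>) * iexp (u * \<sigma> * x))"
    unfolding char_def by (simp add: integral_distr algebra_simps flip: exp_add)
  also have "\<dots> = iexp (u * \<mu>) * char std_normal_distribution (u * \<sigma>)"
    unfolding char_def by simp
  also have "\<dots> = iexp (u * \<mu>) * exp (- (u * \<sigma>)\<^sup>2 / 2)"
    by (simp add: char_std_normal_distribution exp_of_real)
  finally show ?thesis .
qed

lemma Basis_vec_eq: "(Basis :: (real ^ 'n) set) = (\<lambda>i. axis i 1) ` UNIV"
  by (auto simp: Basis_vec_def)

text \<open>Brownian increments are specified by a product over the index type, whereas integration
  over \<open>real ^ 'n\<close> factors over \<open>Basis\<close>; the bijection between indices and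
  axis vectors connects the two.\<close>

lemma prod_UNIV_vec_nth:
  fixes x :: "real ^ 'n"
  shows "(\<Prod>i\<in>UNIV. g i (x $ i)) = (\<Prod>b\<in>Basis. g (axis_index b) (x \<bullet> b))"
  unfolding Basis_vec_eq
  by (subst prod.reindex) (auto simp: inj_on_def axis_eq_axis cart_eq_inner_axis[symmetric])

text \<open>Density and exponential both split over coordinates, so the integral factors into
  one-dimensional normal ones, evaluated at \<open>u * (c \<bullet> b)\<close>. The exponents add up
  to the squared norm of \<open>c\<close>.\<close>

lemma char_inner_gaussian_vector:
  fixes D :: "'a \<Rightarrow> real ^ 'n"
  assumes D: "distributed M lborel D (\<lambda>x. ennreal (\<Prod>i\<in>UNIV. normal_density 0 \<sigma> (x $ i)))"
    and \<sigma>: "0 < \<sigma>"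
  shows "char (distr M borel (\<lambda>\<omega>. c \<bullet> D \<omega>)) u = exp (- u\<^sup>2 * (\<sigma>\<^sup>2 * (norm c)\<^sup>2) / 2)"
proof -
  have [measurable]: "D \<in> borel_measurable M" using distributed_measurable[OF D] by simp
  define f where "f b y = normal_density 0 \<sigma> y * iexp (u * (c \<bullet> b) * y)" for b and y :: real
  have f: "integrable lborel (f b)" for b
    unfolding f_def
    by (rule Bochner_Integration.integrable_bound[OF integrable_normal_density[OF \<sigma>, of 0]])
       (auto simp: norm_mult)
  have int_f: "(LINT y|lborel. f b y) = exp (- u\<^sup>2 * \<sigma>\<^sup>2 * (c \<bullet> b)\<^sup>2 / 2)" for b
    using char_normal[OF \<sigma>, of 0 "u * (c \<bullet> b)"] unfolding char_def f_def
    by (subst (asm) integral_density) (auto simp: scaleR_conv_of_real power_mult_distrib mult_ac)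
  have "char (distr M borel (\<lambda>\<omega>. c \<bullet> D \<omega>)) u = (LINT \<omega>|M. iexp (u * (c \<bullet> D \<omega>)))"
    by (simp add: char_def integral_distr)
  also have "\<dots> = (LINT x|distr M lborel D. iexp (u * (c \<bullet> x)))"
    by (simp add: integral_distr)
  also have "\<dots> = (LINT x|lborel. (\<Prod>i\<in>UNIV. normal_density 0 \<sigma> (x $ i)) *\<^sub>R iexp (u * (c \<bullet> x)))"
    unfolding distributed_distr_eq_density[OF D]
    by (rule integral_density) (auto intro!: prod_nonneg)
  also have "\<dots> = (LINT x|lborel. (\<Prod>b\<in>Basis. f b (x \<bullet> b)))"
  proof (rule Bochner_Integration.integral_cong[OF refl])
    fix x :: "real ^ 'n"
    have "iexp (u * (c \<bullet> x)) = (\<Prod>b\<in>Basis. iexp (u * (c \<bullet> b) * (x \<bullet> b)))"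
      by (simp add: exp_sum[symmetric] euclidean_inner[of c x] sum_distrib_left mult_ac)
    then show "(\<Prod>i\<in>UNIV. normal_density 0 \<sigma> (x $ i)) *\<^sub>R iexp (u * (c \<bullet> x)) = (\<Prod>b\<in>Basis. f b (x \<bullet> b))"
      unfolding prod_UNIV_vec_nth[of "\<lambda>_. normal_density 0 \<sigma>"] f_def by (simp add: prod.distrib scaleR_conv_of_real)
  qed
  also have "\<dots> = (\<Prod>b\<in>Basis. complex_of_real (exp (- u\<^sup>2 * \<sigma>\<^sup>2 * (c \<bullet> b)\<^sup>2 / 2)))"
    by (simp add: integral_lborel_prod f int_f)
  also have "\<dots> = complex_of_real (exp (\<Sum>b\<in>Basis. - u\<^sup>2 * \<sigma>\<^sup>2 * (c \<bullet> b)\<^sup>2 / 2))"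
    by (simp only: exp_sum[OF finite_Basis] of_real_prod)
  also have "(\<Sum>b\<in>Basis. - u\<^sup>2 * \<sigma>\<^sup>2 * (c \<bullet> b)\<^sup>2 / 2) = - u\<^sup>2 * (\<sigma>\<^sup>2 * (norm c)\<^sup>2) / 2"
    by (simp only: power2_norm_eq_inner euclidean_inner[of c c] sum_distrib_left sum_divide_distrib)
       (simp add: power2_eq_square mult_ac)
  finally show ?thesis .
qed

section \<open>Independence from characteristic functions\<close>

lemma integral_indicator_vimage:
  fixes Y :: "'a \<Rightarrow> 'b::topological_space"
  assumes "Y \<in> borel_measurable M" "B \<in> sets borel"
  shows "(LINT \<omega>|M. indicator B (Y \<omega>)) = measure M (Y -` B \<inter> space M)"
proof -
  have "(LINT \<omega>|M. indicat_real B (Y \<omega>)) = (LINT \<omega>|M. indicat_real (Y -` B \<inter> space M) \<omega>)"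
    by (intro Bochner_Integration.integral_cong) (auto simp: indicator_def)
  also have"\<dots> = measure M (Y -` B \<inter> space M)"
    using assms by (subst Bochner_Integration.integral_indicator) (auto simp: Int_absorb2)
  finally show ?thesis .
qed

text \<open>Independence of variables is about the generated sigma-algebras; preimages form
  intersection-stable generators, so the product rule on them suffices.\<close>

lemma (in prob_space) indep_varI:
  assumes [measurable]: "random_variable S X" "random_variable T Y"
    and prod: "\<And>A B. A \<in> sets S \<Longrightarrow> B \<in> sets T \<Longrightarrow>
      prob ((X -` A \<inter> space M) \<inter> (Y -` B \<inter> space M)) = prob (X -` A \<inter> space M) * prob (Y -` B \<inter> space M)"
  shows "indep_var S X T Y"
proof -
  have stable: "Int_stable {Z -` A \<inter> space M |A. A \<in> sets N}" for Z :: "'a \<Rightarrow> 'c" and N :: "'c measure"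
  proof (rule Int_stableI)
    fix a b assume "a \<in> {Z -` A \<inter> space M |A. A \<in> sets N}" "b \<in> {Z -` A \<inter> space M |A. A \<in> sets N}"
    then obtain A B where "a = Z -` A \<inter> space M" "b = Z -` B \<inter> space M" "A \<in> sets N" "B \<in> sets N" by auto
    then show "a \<inter> b \<in> {Z -` A \<inter> space M |A. A \<in> sets N}"
      by (intro CollectI exI[of _ "A \<inter> B"]) auto
  qed
  show ?thesis
    unfolding indep_var_eq
    by (intro conjI assms(1,2) indep_set_sigma_sets indep_setI stable) (auto simp: prod)
qed

text \<open>If \<open>w\<close> has positive expectation, normalising it gives a density, and the
  hypothesis says that \<open>Y\<close> has the same characteristic function under the weighted
  measure as under \<open>M\<close>. Levy uniqueness equates the laws; evaluating on
  \<open>B\<close> and undoing the normalisation gives the claim. A weight of expectation 0 vanishes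
  almost surely.\<close>

lemma (in prob_space) expectation_indicator_char_factor:
  fixes Y :: "'a \<Rightarrow> real" and w :: "'a \<Rightarrow> real"
  assumes Y[measurable]: "Y \<in> borel_measurable M" and w[measurable]: "w \<in> borel_measurable M"
    and w0: "\<And>\<omega>. 0 \<le> w \<omega>" and wb: "\<And>\<omega>. w \<omega> \<le> b"
    and char: "\<And>v. (LINT \<omega>|M. w \<omega> *\<^sub>R iexp (v * Y \<omega>)) = expectation w *\<^sub>R (LINT \<omega>|M. iexp (v * Y \<omega>))"
    and B: "B \<in> sets borel"
  shows "(LINT \<omega>|M. w \<omega> * indicator B (Y \<omega>)) = expectation w * prob (Y -` B \<inter> space M)"
proof -
  have wi: "integrable M w"
    by (rule integrable_const_bound[of _ b]) (use w0 wb in auto)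
  show ?thesis
  proof (cases "expectation w = 0")
    case True
    then have "AE \<omega> in M. w \<omega> = 0"
      using integral_nonneg_eq_0_iff_AE[OF wi] w0 by simp
    then have "(LINT \<omega>|M. w \<omega> * indicator B (Y \<omega>)) = (LINT \<omega>|M. 0)"
      by (intro integral_cong_AE) (use B in auto)
    then show ?thesis using True by simp
  next
    case False
    define e where "e = expectation w"
    have e: "0 < e" using False w0 by (simp add: e_def less_le)
    define N where "N = density M (\<lambda>\<omega>. w \<omega> / e)"
    have "emeasure N (space N) = (\<integral>\<^sup>+\<omega>. ennreal (w \<omega> / e) \<partial>M)"
      unfolding N_def by (simp add: emeasure_density cong: nn_integral_cong)
    also have "\<dots> = ennreal (LINT \<omega>|M. w \<omega> / e)"
      using w0 e wi by (intro nn_integral_eq_integral) auto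
    also have "\<dots> = 1" using e by (simp add: e_def[symmetric])
    finally interpret N: prob_space N by (rule prob_spaceI)
    have YN[measurable]: "Y \<in> borel_measurable N" unfolding N_def by simp
    have "char (distr N borel Y) = char (distr M borel Y)"
    proof
      fix v
      have "char (distr N borel Y) v = (LINT \<omega>|N. iexp (v * Y \<omega>))"
        by (simp add: char_def integral_distr)
      also have "\<dots> = (LINT \<omega>|M. (w \<omega> / e) *\<^sub>R iexp (v * Y \<omega>))"
        unfolding N_def using w0 e by (intro integral_density) auto
      also have "\<dots> = (1 / e) *\<^sub>R (LINT \<omega>|M. w \<omega> *\<^sub>R iexp (v * Y \<omega>))"
        by (subst integral_scaleR_right[symmetric]) simp
      also have "\<dots> = char (distr M borel Y) v"
        unfolding char using e by (simp add: char_def integral_distr e_def[symmetric])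
      finally show "char (distr N borel Y) v = char (distr M borel Y) v" .
    qed
    then have "distr N borel Y = distr M borel Y"
      by (intro Levy_uniqueness real_distribution_distr N.real_distribution_distr) auto
    then have "measure (distr N borel Y) B = measure (distr M borel Y) B" by simp
    then have "measure N (Y -` B \<inter> space M) = prob (Y -` B \<inter> space M)"
      using B by (simp add: measure_distr N_def)
    moreover have "measure N (Y -` B \<inter> space M) = (LINT \<omega>|N. indicator B (Y \<omega>))"
      using integral_indicator_vimage[OF YN B] by (simp add: N_def)
    moreover have "\<dots> = (LINT \<omega>|M. (w \<omega> / e) * indicator B (Y \<omega>))"
      unfolding N_def using w0 e B by (subst integral_density) auto
    moreover have "\<dots> = (LINT \<omega>|M. w \<omega> * indicator B (Y \<omega>)) / e" by simp
    ultimately show ?thesis using e by (simp add: e_def field_simps)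
  qed
qed

text \<open>Kac's theorem. Two applications of one-dimensional uniqueness replace the uniqueness theorem
  in the plane: first for \<open>Y\<close> under the positive weights \<open>2 + cos (u X)\<close> and \<open>2 + sin (u X)\<close>, then for
  \<open>X\<close> under the weight \<open>1\<^sub>B(Y)\<close>.\<close>

lemma (in prob_space) indep_var_char_factor:
  fixes X Y :: "'a \<Rightarrow> real"
  assumes X[measurable]: "X \<in> borel_measurable M" and Y[measurable]: "Y \<in> borel_measurable M"
    and factor: "\<And>u v. (LINT \<omega>|M. iexp (u * X \<omega> + v * Y \<omega>)) =
      (LINT \<omega>|M. iexp (u * X \<omega>)) * (LINT \<omega>|M. iexp (v * Y \<omega>))"
  shows "indep_var borel X borel Y"
proof -
  have ii[simp]: "integrable M (\<lambda>\<omega>. iexp (f \<omega>))" if [measurable]: "f \<in> borel_measurable M" for f :: "'a \<Rightarrow> real"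
    by (rule integrable_const_bound[of _ 1]) auto
  have ib[simp]: "integrable M (\<lambda>\<omega>. cos (f \<omega>))" "integrable M (\<lambda>\<omega>. sin (f \<omega>))"
    if [measurable]: "f \<in> borel_measurable M" for f :: "'a \<Rightarrow> real"
    by (rule integrable_const_bound[of _ 1]; simp)+
  have cos_iexp: "complex_of_real (cos x) = (iexp x + iexp (- x)) / 2"
    and sin_iexp: "complex_of_real (sin x) = (iexp x - iexp (- x)) / (2 * \<i>)" for x
    by (simp_all add: cos_exp_eq sin_exp_eq cos_of_real[symmetric] sin_of_real[symmetric])
  \<comment> \<open>By Euler's formulas, cosine and sine are combinations of the exponentials at
    \<open>u\<close> and \<open>- u\<close>, to which \<open>factor\<close> applies.\<close>
  have cosw: "(LINT \<omega>|M. cos (u * X \<omega>) *\<^sub>R iexp (v * Y \<omega>)) = expectation (\<lambda>\<omega>. cos (u * X \<omega>)) *\<^sub>R (LINT \<omega>|M. iexp (v * Y \<omega>))"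
    and sinw: "(LINT \<omega>|M. sin (u * X \<omega>) *\<^sub>R iexp (v * Y \<omega>)) = expectation (\<lambda>\<omega>. sin (u * X \<omega>)) *\<^sub>R (LINT \<omega>|M. iexp (v * Y \<omega>))"
    for u v
  proof -
    have "(LINT \<omega>|M. cos (u * X \<omega>) *\<^sub>R iexp (v * Y \<omega>))
        = (LINT \<omega>|M. (iexp (u * X \<omega> + v * Y \<omega>) + iexp ((- u) * X \<omega> + v * Y \<omega>)) / 2)"
      unfolding scaleR_conv_of_real cos_iexp
      by (intro Bochner_Integration.integral_cong refl) (simp add: algebra_simps add_divide_distrib flip: exp_add)
    also have "\<dots> = ((LINT \<omega>|M. iexp (u * X \<omega> + v * Y \<omega>)) + (LINT \<omega>|M. iexp ((- u) * X \<omega> + v * Y \<omega>))) / 2"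
      by (subst integral_divide_zero, subst Bochner_Integration.integral_add[OF ii ii]) auto
    also have "\<dots> = ((LINT \<omega>|M. iexp (u * X \<omega>)) + (LINT \<omega>|M. iexp ((- u) * X \<omega>))) / 2 * (LINT \<omega>|M. iexp (v * Y \<omega>))"
      unfolding factor by (simp only: distrib_right times_divide_eq_left)
    also have "((LINT \<omega>|M. iexp (u * X \<omega>)) + (LINT \<omega>|M. iexp ((- u) * X \<omega>))) / 2
        = (LINT \<omega>|M. complex_of_real (cos (u * X \<omega>)))"
      unfolding cos_iexp minus_mult_left
      by (subst integral_divide_zero, subst Bochner_Integration.integral_add[OF ii ii]) auto
    finally show "(LINT \<omega>|M. cos (u * X \<omega>) *\<^sub>R iexp (v * Y \<omega>)) = expectation (\<lambda>\<omega>. cos (u * X \<omega>)) *\<^sub>R (LINT \<omega>|M. iexp (v * Y \<omega>))"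
      by (simp add: scaleR_conv_of_real)
    have "(LINT \<omega>|M. sin (u * X \<omega>) *\<^sub>R iexp (v * Y \<omega>))
        = (LINT \<omega>|M. (iexp (u * X \<omega> + v * Y \<omega>) - iexp ((- u) * X \<omega> + v * Y \<omega>)) / (2 * \<i>))"
      unfolding scaleR_conv_of_real sin_iexp
      by (intro Bochner_Integration.integral_cong refl) (simp add: algebra_simps diff_divide_distrib flip: exp_add)
    also have "\<dots> = ((LINT \<omega>|M. iexp (u * X \<omega> + v * Y \<omega>)) - (LINT \<omega>|M. iexp ((- u) * X \<omega> + v * Y \<omega>))) / (2 * \<i>)"
      by (subst integral_divide_zero, subst Bochner_Integration.integral_diff[OF ii ii]) auto
    also have "\<dots> = ((LINT \<omega>|M. iexp (u * X \<omega>)) - (LINT \<omega>|M. iexp ((- u) * X \<omega>))) / (2 * \<i>) * (LINT \<omega>|M. iexp (v * Y \<omega>))"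
      unfolding factor by (simp only: left_diff_distrib times_divide_eq_left)
    also have "((LINT \<omega>|M. iexp (u * X \<omega>)) - (LINT \<omega>|M. iexp ((- u) * X \<omega>))) / (2 * \<i>)
        = (LINT \<omega>|M. complex_of_real (sin (u * X \<omega>)))"
      unfolding sin_iexp minus_mult_left
      by (subst integral_divide_zero, subst Bochner_Integration.integral_diff[OF ii ii]) auto
    finally show "(LINT \<omega>|M. sin (u * X \<omega>) *\<^sub>R iexp (v * Y \<omega>)) = expectation (\<lambda>\<omega>. sin (u * X \<omega>)) *\<^sub>R (LINT \<omega>|M. iexp (v * Y \<omega>))"
      by (simp add: scaleR_conv_of_real)
  qed
  have Y_weighted: "(LINT \<omega>|M. g \<omega> * indicator B (Y \<omega>)) = expectation g * prob (Y -` B \<inter> space M)"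
    if [measurable]: "g \<in> borel_measurable M" "B \<in> sets borel" and g: "\<And>\<omega>. \<bar>g \<omega>\<bar> \<le> 1"
      and gw: "\<And>v. (LINT \<omega>|M. g \<omega> *\<^sub>R iexp (v * Y \<omega>)) = expectation g *\<^sub>R (LINT \<omega>|M. iexp (v * Y \<omega>))"
    for g :: "'a \<Rightarrow> real" and B
  proof -
    have gi: "integrable M g" by (rule integrable_const_bound[of _ 1]) (use g in auto)
    have gY: "integrable M (\<lambda>\<omega>. g \<omega> *\<^sub>R iexp (v * Y \<omega>))" for v
      by (rule integrable_const_bound[of _ 1]) (use g in auto)
    have gB: "integrable M (\<lambda>\<omega>. g \<omega> * indicator B (Y \<omega>))"
      by (rule integrable_const_bound[of _ 1]) (use g in \<open>auto simp: indicator_def\<close>)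
    have iB: "integrable M (\<lambda>\<omega>. indicator B (Y \<omega>) :: real)"
      by (rule integrable_const_bound[of _ 1]) (auto simp: indicator_def)
    have pB: "(LINT \<omega>|M. indicator B (Y \<omega>)) = prob (Y -` B \<inter> space M)"
      by (rule integral_indicator_vimage) auto
    \<comment> \<open>As \<open>g\<close> may change sign, it cannot serve as a density;
      \<open>2 + g\<close> lies between 1 and 3, and the contribution of the constant 2 cancels at
      the end.\<close>
    have "(LINT \<omega>|M. (2 + g \<omega>) * indicator B (Y \<omega>)) = expectation (\<lambda>\<omega>. 2 + g \<omega>) * prob (Y -` B \<inter> space M)"
    proof (rule expectation_indicator_char_factor[where b=3])
      show "0 \<le> 2 + g \<omega>" "2 + g \<omega> \<le> 3" for \<omega> using g[of \<omega>] by auto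
      show "(LINT \<omega>|M. (2 + g \<omega>) *\<^sub>R iexp (v * Y \<omega>)) = expectation (\<lambda>\<omega>. 2 + g \<omega>) *\<^sub>R (LINT \<omega>|M. iexp (v * Y \<omega>))" for v
        using gY[of v] gi gw[of v] by (simp add: scaleR_add_left prob_space del: of_real_mult)
    qed auto
    then show ?thesis using gB iB gi by (simp add: distrib_right prob_space pB)
  qed
  have joint: "(LINT \<omega>|M. indicator B (Y \<omega>) * indicator A (X \<omega>)) = prob (Y -` B \<inter> space M) * prob (X -` A \<inter> space M)"
    if [measurable]: "A \<in> sets borel" "B \<in> sets borel" for A B
  proof -
    have pB: "expectation (\<lambda>\<omega>. indicator B (Y \<omega>)) = prob (Y -` B \<inter> space M)"
      by (rule integral_indicator_vimage) auto
    have "(LINT \<omega>|M. indicator B (Y \<omega>) * indicator A (X \<omega>)) = expectation (\<lambda>\<omega>. indicator B (Y \<omega>)) * prob (X -` A \<inter> space M)"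
    proof (rule expectation_indicator_char_factor[where b=1])
      fix u
      have i: "integrable M (\<lambda>\<omega>. cos (u * X \<omega>) * indicator B (Y \<omega>))" "integrable M (\<lambda>\<omega>. sin (u * X \<omega>) * indicator B (Y \<omega>))"
        by (rule integrable_const_bound[of _ 1]; simp add: indicator_def)+
      \<comment> \<open>The weighted identities for \<open>Y\<close>, read with the roles exchanged,
        give the real and imaginary parts of the characteristic function of \<open>X\<close> under
        the weight \<open>indicator B (Y \<omega>)\<close>.\<close>
      have c: "(LINT \<omega>|M. cos (u * X \<omega>) * indicator B (Y \<omega>)) = expectation (\<lambda>\<omega>. cos (u * X \<omega>)) * prob (Y -` B \<inter> space M)"
        by (rule Y_weighted) (use cosw in auto)
      have s: "(LINT \<omega>|M. sin (u * X \<omega>) * indicator B (Y \<omega>)) = expectation (\<lambda>\<omega>. sin (u * X \<omega>)) * prob (Y -` B \<inter> space M)"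
        by (rule Y_weighted) (use sinw in auto)
      have "(LINT \<omega>|M. (indicator B (Y \<omega>) :: real) *\<^sub>R iexp (u * X \<omega>))
         = (LINT \<omega>|M. complex_of_real (cos (u * X \<omega>) * indicator B (Y \<omega>)) + \<i> * complex_of_real (sin (u * X \<omega>) * indicator B (Y \<omega>)))"
        by (intro Bochner_Integration.integral_cong refl)
           (simp add: cis_conv_exp[symmetric] complex_eq_iff mult_ac del: of_real_mult)
      also have "\<dots> = complex_of_real (LINT \<omega>|M. cos (u * X \<omega>) * indicator B (Y \<omega>)) + \<i> * complex_of_real (LINT \<omega>|M. sin (u * X \<omega>) * indicator B (Y \<omega>))"
        using i by (subst Bochner_Integration.integral_add) (auto simp del: of_real_mult)
      also have "\<dots> = prob (Y -` B \<inter> space M) *\<^sub>R (complex_of_real (LINT \<omega>|M. cos (u * X \<omega>)) + \<i> * complex_of_real (LINT \<omega>|M. sin (u * X \<omega>)))"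
        unfolding c s by (simp add: scaleR_conv_of_real algebra_simps)
      also have "complex_of_real (LINT \<omega>|M. cos (u * X \<omega>)) + \<i> * complex_of_real (LINT \<omega>|M. sin (u * X \<omega>))
         = (LINT \<omega>|M. complex_of_real (cos (u * X \<omega>)) + \<i> * complex_of_real (sin (u * X \<omega>)))"
        by (subst Bochner_Integration.integral_add) auto
      also have "\<dots> = (LINT \<omega>|M. iexp (u * X \<omega>))"
        by (intro Bochner_Integration.integral_cong refl)
           (simp add: cis_conv_exp[symmetric] complex_eq_iff del: of_real_mult)
      finally show "(LINT \<omega>|M. (indicator B (Y \<omega>) :: real) *\<^sub>R iexp (u * X \<omega>)) = expectation (\<lambda>\<omega>. indicator B (Y \<omega>)) *\<^sub>R (LINT \<omega>|M. iexp (u * X \<omega>))"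
        by (simp add: pB)
    qed (auto simp: indicator_def)
    then show ?thesis by (simp add: pB)
  qed
  have XY: "prob ((X -` A \<inter> space M) \<inter> (Y -` B \<inter> space M)) = prob (X -` A \<inter> space M) * prob (Y -` B \<inter> space M)"
    if [measurable]: "A \<in> sets borel" "B \<in> sets borel" for A B
  proof -
    have "prob ((X -` A \<inter> space M) \<inter> (Y -` B \<inter> space M)) = (LINT \<omega>|M. indicator B (Y \<omega>) * indicator A (X \<omega>))"
      using integral_indicator_vimage[of "\<lambda>\<omega>. (Y \<omega>, X \<omega>)" M "B \<times> A"]
      by (simp add: indicator_times vimage_Times) (simp add: vimage_def Int_def conj_ac borel_Times)
    then show ?thesis using joint[OF that] by simp
  qed
  show ?thesis
    by (rule indep_varI[OF X Y XY])
qed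

section \<open>Wiener integrals are Gaussian\<close>

text \<open>Summation by parts. \<open>G\<close> is instantiated with
  \<open>indicator {0<..s} r *\<^sub>R v\<close> and with \<open>v \<bullet> W s \<omega>\<close>;
  one statement for both ensures that a step function and its integral receive the same coefficients
  at the same times.\<close>

lemma sum_list_step_regroup:
  fixes G :: "real \<Rightarrow> 'v::real_vector \<Rightarrow> 'w::real_vector"
  assumes lin: "\<And>s. linear (G s)" and A: "finite A" "\<And>a b v. (a, b, v) \<in> set ps \<Longrightarrow> a \<in> A \<and> b \<in> A"
  shows "(\<Sum>(a, b, v)\<leftarrow>ps. G b v - G a v) =
    (\<Sum>s\<in>A. G s (\<Sum>(a, b, v)\<leftarrow>ps. (if s = b then v else 0) - (if s = a then v else 0)))"
  using A(2)
proof (induction ps)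
  case Nil
  then show ?case by (simp add: linear_0[OF lin])
next
  case (Cons p ps)
  obtain a b v where p: "p = (a, b, v)" by (cases p)
  have ab: "a \<in> A" "b \<in> A" using Cons.prems[of a b v] by (auto simp: p)
  have G_if: "G s (if s = t then v else 0) = (if s = t then G t v else 0)" for s t
    by (simp add: linear_0[OF lin])
  have "(\<Sum>(a, b, v)\<leftarrow>ps. G b v - G a v) =
      (\<Sum>s\<in>A. G s (\<Sum>(a, b, v)\<leftarrow>ps. (if s = b then v else 0) - (if s = a then v else 0)))"
    by (rule Cons.IH) (use Cons.prems in auto)
  then show ?case
    using ab A(1)
    by (simp add: p linear_add[OF lin] linear_diff[OF lin] G_if sum.distrib sum_subtractf sum.delta)
qed

lemma brownian_motion_onD:
  assumes "brownian_motion_on M T W"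
  shows "prob_space M" "\<And>t. 0 \<le> t \<Longrightarrow> t \<le> T \<Longrightarrow> W t \<in> borel_measurable M" "AE \<omega> in M. W 0 \<omega> = 0"
  using assms by (auto simp: brownian_motion_on_def)

lemma measurable_natural_filtration:
  assumes "0 \<le> s" "s \<le> t"
  shows "W s \<in> borel_measurable (natural_filtration M W t)"
proof (rule measurableI)
  fix B :: "'b set" assume "B \<in> sets borel"
  then show "W s -` B \<inter> space (natural_filtration M W t) \<in> sets (natural_filtration M W t)"
    using assms by (auto simp: natural_filtration_def past_events_def space_measure_of_conv)
qed simp

definition brownian_comb :: "(real \<Rightarrow> 'a \<Rightarrow> real ^ 'n) \<Rightarrow> real set \<Rightarrow> (real \<Rightarrow> real ^ 'n) \<Rightarrow> 'a \<Rightarrow> real" where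
  "brownian_comb W A c \<omega> = (\<Sum>s\<in>A. c s \<bullet> W s \<omega>)"

text \<open>Since \<open>W 0\<close> is almost surely 0, \<open>W s\<close> is the integral of the
  indicator of \<open>{0<..s}\<close>. This is therefore the integrand behind
  \<open>brownian_comb W A c\<close>, and its squared norm will be the variance.\<close>

definition comb_integrand :: "real set \<Rightarrow> (real \<Rightarrow> real ^ 'n) \<Rightarrow> real \<Rightarrow> real ^ 'n" where
  "comb_integrand A c r = (\<Sum>s\<in>A. indicator {0<..s} r *\<^sub>R c s)"

text \<open>A linear functional of the increment generates a sigma-algebra contained in that of the
  increment, so independence passes from the vector to the scalar.\<close>

lemma indep_past_increment:
  fixes W :: "real \<Rightarrow> 'a \<Rightarrow> real ^ 'n"
  assumes BM: "brownian_motion_on M T W" and st: "0 \<le> s" "s < t" "t \<le> T"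
    and X: "X \<in> borel_measurable (natural_filtration M W s)"
  shows "prob_space.indep_var M borel X borel (\<lambda>\<omega>. c \<bullet> (W t \<omega> - W s \<omega>))"
proof -
  interpret prob_space M using BM by (rule brownian_motion_onD)
  have [measurable]: "W t \<in> borel_measurable M" "W s \<in> borel_measurable M"
    using brownian_motion_onD(2)[OF BM] st by auto
  have indep: "indep_set (sets (natural_filtration M W s))
      {(\<lambda>\<omega>. W t \<omega> - W s \<omega>) -` B \<inter> space M | B. B \<in> sets borel}"
    using BM st by (auto simp: brownian_motion_on_def)
  have sp: "space (natural_filtration M W s) = space M"
    by (simp add: natural_filtration_def space_measure_of_conv)
  have ev: "sets (natural_filtration M W s) \<subseteq> events"
    using indep by (simp add: indep_sets2_eq)
  have XM: "X \<in> borel_measurable M"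
    using X ev sp by (auto simp: measurable_def)
  have pre: "(\<lambda>\<omega>. c \<bullet> (W t \<omega> - W s \<omega>)) -` B \<inter> space M = (\<lambda>\<omega>. W t \<omega> - W s \<omega>) -` ((\<lambda>x. c \<bullet> x) -` B) \<inter> space M" for B
    by auto
  have "(\<lambda>x. c \<bullet> x) -` B \<in> sets borel" if "B \<in> sets borel" for B :: "real set"
    using measurable_sets[OF _ that, of "\<lambda>x. c \<bullet> x" borel] by simp
  then have prod: "prob ((X -` A \<inter> space M) \<inter> ((\<lambda>\<omega>. c \<bullet> (W t \<omega> - W s \<omega>)) -` B \<inter> space M))
      = prob (X -` A \<inter> space M) * prob ((\<lambda>\<omega>. c \<bullet> (W t \<omega> - W s \<omega>)) -` B \<inter> space M)"
    if "A \<in> sets borel" "B \<in> sets borel" for A B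
    unfolding pre using that measurable_sets[OF X] by (intro indep_setD[OF indep]) (auto simp: sp)
  show ?thesis
    by (rule indep_varI[OF XM _ prod]) auto
qed

text \<open>By induction on the largest time \<open>b\<close>, with \<open>W\<^sub>b\<close> written as \<open>W\<^sub>m + (W\<^sub>b - W\<^sub>m)\<close> for the preceding time \<open>m\<close>:
  the coefficient of \<open>W\<^sub>b\<close> is added to that of \<open>W\<^sub>m\<close>, and the increment is independent of the rest.
  Time \<open>0\<close> is always included, so that \<open>m\<close> exists.\<close>

lemma char_brownian_comb:
  fixes W :: "real \<Rightarrow> 'a \<Rightarrow> real ^ 'n"
  assumes BM: "brownian_motion_on M T W" and A: "finite A" "A \<subseteq> {0<..T}" and T: "0 \<le> T"
  shows "\<exists>q\<ge>0. (\<integral>\<^sup>+r. ennreal ((norm (comb_integrand (insert 0 A) c r))\<^sup>2) \<partial>lborel) = ennreal q \<and>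
    (\<forall>u. char (distr M borel (brownian_comb W (insert 0 A) c)) u = exp (- u\<^sup>2 * q / 2))"
  using A
proof (induction A arbitrary: c rule: finite_linorder_max_induct)
  case empty
  interpret prob_space M using BM by (rule brownian_motion_onD)
  have [measurable]: "W 0 \<in> borel_measurable M" using brownian_motion_onD(2)[OF BM] T by auto
  have "(\<lambda>\<omega>. iexp (u * brownian_comb W {0} c \<omega>)) \<in> borel_measurable M" for u
    unfolding brownian_comb_def by simp
  then have "(LINT \<omega>|M. iexp (u * brownian_comb W {0} c \<omega>)) = (LINT \<omega>|M. 1)" for u
    by (rule integral_cong_AE) (use brownian_motion_onD(3)[OF BM] in \<open>auto simp: brownian_comb_def\<close>)
  then have "char (distr M borel (brownian_comb W {0} c)) u = 1" for u
    unfolding char_def by (subst integral_distr) (auto simp: brownian_comb_def[abs_def] prob_space)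
  moreover have "(\<integral>\<^sup>+r. ennreal ((norm (comb_integrand {0} c r))\<^sup>2) \<partial>lborel) = 0"
    by (simp add: comb_integrand_def)
  ultimately show ?case by (intro exI[of _ 0]) auto
next
  case (insert b A)
  interpret prob_space M using BM by (rule brownian_motion_onD)
  define m where "m = Max (insert 0 A)"
  have m: "m \<in> insert 0 A"
    unfolding m_def using insert.hyps(1) by (intro Max_in) auto
  have m_max: "s \<le> m" if "s \<in> insert 0 A" for s
    unfolding m_def using insert.hyps(1) that by (intro Max_ge) auto
  have mb: "0 \<le> m" "m < b" "b \<le> T" and b: "b \<notin> insert 0 A"
    using m insert.hyps insert.prems m_max by auto
  have W[measurable]: "W s \<in> borel_measurable M" if "s \<in> insert b (insert 0 A)" for s
    using brownian_motion_onD(2)[OF BM, of s] that insert.prems T by auto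
  define c' where "c' = c(m := c m + c b)"
  have comb: "brownian_comb W (insert 0 (insert b A)) c \<omega> =
      brownian_comb W (insert 0 A) c' \<omega> + c b \<bullet> (W b \<omega> - W m \<omega>)" for \<omega>
  proof -
    have "brownian_comb W (insert 0 A) c' \<omega> = (\<Sum>s\<in>insert 0 A. c s \<bullet> W s \<omega> + (if s = m then c b \<bullet> W m \<omega> else 0))"
      unfolding brownian_comb_def by (intro sum.cong) (auto simp: c'_def inner_add_left)
    also have "\<dots> = brownian_comb W (insert 0 A) c \<omega> + c b \<bullet> W m \<omega>"
      unfolding brownian_comb_def sum.distrib using m insert.hyps(1) by (subst sum.delta) auto
    finally show ?thesis
      unfolding insert_commute[of 0 b] using b insert.hyps(1)
      by (simp add: brownian_comb_def[of W "insert b (insert 0 A)"] brownian_comb_def[of W "insert 0 A" c] inner_diff_right del: insert_iff)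
  qed
  have integrand: "comb_integrand (insert 0 (insert b A)) c r =
      comb_integrand (insert 0 A) c' r + indicator {m<..b} r *\<^sub>R c b" for r
  proof -
    have "comb_integrand (insert 0 A) c' r = (\<Sum>s\<in>insert 0 A. indicator {0<..s} r *\<^sub>R c s + (if s = m then indicator {0<..m} r *\<^sub>R c b else 0))"
      unfolding comb_integrand_def by (intro sum.cong) (auto simp: c'_def scaleR_add_right)
    also have "\<dots> = comb_integrand (insert 0 A) c r + indicator {0<..m} r *\<^sub>R c b"
      unfolding comb_integrand_def sum.distrib using m insert.hyps(1) by (subst sum.delta) auto
    finally have *: "comb_integrand (insert 0 A) c' r = comb_integrand (insert 0 A) c r + indicator {0<..m} r *\<^sub>R c b" .
    have "indicat_real {0<..b} r = indicator {0<..m} r + indicator {m<..b} r"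
      using mb by (auto simp: indicator_def)
    moreover have "comb_integrand (insert b (insert 0 A)) c r = indicator {0<..b} r *\<^sub>R c b + comb_integrand (insert 0 A) c r"
      unfolding comb_integrand_def using b insert.hyps(1) by (intro sum.insert) auto
    ultimately show ?thesis
      unfolding insert_commute[of 0 b] * by (simp add: scaleR_add_left)
  qed
  \<comment> \<open>The old integrand vanishes after time \<open>m\<close> and the new term lives on
    \<open>{m<..b}\<close>: disjoint supports leave no cross term in the squared norm.\<close>
  have vanish: "comb_integrand (insert 0 A) c' r = 0" if "m < r" for r
    unfolding comb_integrand_def using m_max that by (intro sum.neutral) (force simp: indicator_def)
  have [measurable]: "comb_integrand (insert 0 A) c' \<in> borel_measurable borel"
    unfolding comb_integrand_def[abs_def] by measurable
  obtain q where q: "0 \<le> q" "(\<integral>\<^sup>+r. ennreal ((norm (comb_integrand (insert 0 A) c' r))\<^sup>2) \<partial>lborel) = ennreal q"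
    "\<And>u. char (distr M borel (brownian_comb W (insert 0 A) c')) u = exp (- u\<^sup>2 * q / 2)"
    using insert.IH[of c'] insert.prems by auto
  \<comment> \<open>The variance of \<open>c b \<bullet> (W b \<omega> - W m \<omega>)\<close>,
    which is also the squared norm of the new piece of the integrand.\<close>
  let ?p = "(b - m) * (norm (c b))\<^sup>2"
  have "(\<integral>\<^sup>+r. ennreal ((norm (comb_integrand (insert 0 (insert b A)) c r))\<^sup>2) \<partial>lborel)
     = (\<integral>\<^sup>+r. ennreal ((norm (comb_integrand (insert 0 A) c' r))\<^sup>2) + ennreal ((norm (c b))\<^sup>2) * indicator {m<..b} r \<partial>lborel)"
    by (intro nn_integral_cong) (auto simp: integrand vanish indicator_def)
  also have "\<dots> = ennreal q + ennreal ((norm (c b))\<^sup>2) * ennreal (b - m)"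
    using mb by (subst nn_integral_add) (auto simp: q nn_integral_cmult_indicator)
  also have "\<dots> = ennreal (q + ?p)"
    using mb q(1) by (simp add: ennreal_mult'[symmetric] ennreal_plus[symmetric] mult.commute del: ennreal_plus)
  finally have *: "(\<integral>\<^sup>+r. ennreal ((norm (comb_integrand (insert 0 (insert b A)) c r))\<^sup>2) \<partial>lborel) = ennreal (q + ?p)" .
  have "char (distr M borel (brownian_comb W (insert 0 (insert b A)) c)) u = exp (- u\<^sup>2 * (q + ?p) / 2)" for u
  proof -
    have "brownian_comb W (insert 0 A) c' \<in> borel_measurable (natural_filtration M W m)"
      unfolding brownian_comb_def[abs_def]
    proof (intro borel_measurable_sum borel_measurable_inner borel_measurable_const measurable_natural_filtration m_max)
      show "0 \<le> s" if "s \<in> insert 0 A" for s using that insert.prems by auto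
    qed auto
    then have indep: "indep_var borel (brownian_comb W (insert 0 A) c') borel (\<lambda>\<omega>. c b \<bullet> (W b \<omega> - W m \<omega>))"
      by (rule indep_past_increment[OF BM mb])
    have D: "distributed M lborel (\<lambda>\<omega>. W b \<omega> - W m \<omega>) (\<lambda>x. ennreal (\<Prod>i\<in>UNIV. normal_density 0 (sqrt (b - m)) (x $ i)))"
      using BM mb by (auto simp: brownian_motion_on_def)
    have "char (distr M borel (brownian_comb W (insert 0 (insert b A)) c)) u
        = char (distr M borel (\<lambda>\<omega>. brownian_comb W (insert 0 A) c' \<omega> + c b \<bullet> (W b \<omega> - W m \<omega>))) u"
      by (simp add: comb[abs_def])
    also have "\<dots> = exp (- u\<^sup>2 * q / 2) * exp (- u\<^sup>2 * ?p / 2)"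
      using char_inner_gaussian_vector[OF D, of "c b" u] mb by (simp add: char_distr_add[OF indep] q(3))
    also have "\<dots> = exp (- u\<^sup>2 * (q + ?p) / 2)"
      by (simp add: exp_add[symmetric] field_simps del: of_real_exp flip: of_real_mult)
    finally show ?thesis .
  qed
  with * q(1) mb show ?case by (intro exI[of _ "q + ?p"]) auto
qed

text \<open>The intervals of the triples may overlap, so the single contributions need not be
  independent; collecting coefficients at the endpoints reduces the claim to Brownian values at
  distinct times.\<close>

lemma char_step_integral:
  fixes W :: "real \<Rightarrow> 'a \<Rightarrow> real ^ 'n"
  assumes BM: "brownian_motion_on M T W" and t: "0 \<le> t" "t \<le> T"
    and ps: "\<forall>(a, b, c)\<in>set ps. 0 \<le> a \<and> a \<le> b \<and> b \<le> t"
  shows "\<exists>q\<ge>0. (\<integral>\<^sup>+r\<in>{0..t}. ennreal ((norm (step_function ps r))\<^sup>2) \<partial>lborel) = ennreal q \<and>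
    (\<forall>u. char (distr M borel (step_integral W ps)) u = exp (- u\<^sup>2 * q / 2))"
proof -
  \<comment> \<open>Zero is removed because \<open>char_brownian_comb\<close> takes strictly
    positive times and adjoins 0 by itself.\<close>
  define A where "A = (fst ` set ps \<union> (fst \<circ> snd) ` set ps) - {0}"
  define c :: "real \<Rightarrow> real ^ 'n" where "c s = (\<Sum>(a, b, v)\<leftarrow>ps. (if s = b then v else 0) - (if s = a then v else 0))" for s
  have A: "finite A" "A \<subseteq> {0<..T}" and A_t: "A \<subseteq> {0..t}"
    using ps t by (force simp: A_def)+
  have mem: "a \<in> insert 0 A \<and> b \<in> insert 0 A" if "(a, b, v) \<in> set ps" for a b v
    using that by (force simp: A_def)
  have sf: "step_function ps = comb_integrand (insert 0 A) c"
  proof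
    fix r
    have "indicator {a<..b} r *\<^sub>R v = indicator {0<..b} r *\<^sub>R v - indicator {0<..a} r *\<^sub>R v"
      if "(a, b, v) \<in> set ps" for a b v
    proof -
      have "0 \<le> a" "a \<le> b" using ps that by auto
      then show ?thesis by (auto simp: indicator_def)
    qed
    then have "step_function ps r = (\<Sum>(a, b, v)\<leftarrow>ps. indicator {0<..b} r *\<^sub>R v - indicator {0<..a} r *\<^sub>R v)"
      unfolding step_function_def
      by (intro arg_cong[where f=sum_list] map_cong) auto
    also have "\<dots> = comb_integrand (insert 0 A) c r"
      unfolding comb_integrand_def c_def
      by (rule sum_list_step_regroup) (use A mem in \<open>auto intro!: linearI simp: scaleR_add_right\<close>)
    finally show "step_function ps r = comb_integrand (insert 0 A) c r" .
  qed
  have si: "step_integral W ps = brownian_comb W (insert 0 A) c"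
  proof
    fix \<omega>
    have "step_integral W ps \<omega> = (\<Sum>(a, b, v)\<leftarrow>ps. v \<bullet> W b \<omega> - v \<bullet> W a \<omega>)"
      unfolding step_integral_def by (simp add: inner_diff_right)
    also have "\<dots> = brownian_comb W (insert 0 A) c \<omega>"
      unfolding brownian_comb_def c_def
      by (rule sum_list_step_regroup) (use A mem in \<open>auto intro!: linearI simp: inner_add_left\<close>)
    finally show "step_integral W ps \<omega> = brownian_comb W (insert 0 A) c \<omega>" .
  qed
  \<comment> \<open>All endpoints lie in \<open>{0..t}\<close>, so restricting the integral to this
    interval loses nothing.\<close>
  have "comb_integrand (insert 0 A) c r = 0" if "r \<notin> {0..t}" for r
    unfolding comb_integrand_def using A_t that by (intro sum.neutral) (force simp: indicator_def)
  then have "(\<integral>\<^sup>+r\<in>{0..t}. ennreal ((norm (step_function ps r))\<^sup>2) \<partial>lborel)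
      = (\<integral>\<^sup>+r. ennreal ((norm (comb_integrand (insert 0 A) c r))\<^sup>2) \<partial>lborel)"
    unfolding sf by (intro nn_integral_cong) (auto simp: indicator_def)
  then show ?thesis
    using char_brownian_comb[OF BM A, of c] t by (simp add: si)
qed

section \<open>Square-integrable deterministic integrands\<close>

text \<open>Extension by zero turns integrals over a set into integrals over the line, so that the
  L2 estimates can be stated for an arbitrary measure.\<close>

lemma square_integrable_onD:
  assumes "square_integrable_on A f"
  shows "(\<lambda>s. indicator A s *\<^sub>R f s) \<in> borel_measurable lborel"
    "integrable lborel (\<lambda>s. (norm (indicator A s *\<^sub>R f s))\<^sup>2)"
    "(LINT s:A|lborel. (norm (f s))\<^sup>2) = (LINT s|lborel. (norm (indicator A s *\<^sub>R f s))\<^sup>2)"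
proof -
  have eq: "(norm (indicator A s *\<^sub>R f s))\<^sup>2 = indicator A s *\<^sub>R (norm (f s))\<^sup>2" for s
    by (simp add: indicator_def)
  show "(\<lambda>s. indicator A s *\<^sub>R f s) \<in> borel_measurable lborel"
    "integrable lborel (\<lambda>s. (norm (indicator A s *\<^sub>R f s))\<^sup>2)"
    "(LINT s:A|lborel. (norm (f s))\<^sup>2) = (LINT s|lborel. (norm (indicator A s *\<^sub>R f s))\<^sup>2)"
    unfolding eq using assms
    by (simp_all add: square_integrable_on_def set_borel_measurable_def set_integrable_def set_lebesgue_integral_def)
qed

lemma square_integrable_onI:
  assumes "(\<lambda>s. indicator A s *\<^sub>R f s) \<in> borel_measurable lborel"
    "integrable lborel (\<lambda>s. (norm (indicator A s *\<^sub>R f s))\<^sup>2)"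
  shows "square_integrable_on A f"
proof -
  have eq: "(norm (indicator A s *\<^sub>R f s))\<^sup>2 = indicator A s *\<^sub>R (norm (f s))\<^sup>2" for s
    by (simp add: indicator_def)
  show ?thesis
    using assms unfolding eq
    by (simp add: square_integrable_on_def set_borel_measurable_def set_integrable_def)
qed

lemma set_nn_integral_norm2:
  "(\<integral>\<^sup>+s\<in>A. ennreal ((norm (f s))\<^sup>2) \<partial>M) = (\<integral>\<^sup>+s. ennreal ((norm (indicator A s *\<^sub>R f s))\<^sup>2) \<partial>M)"
  by (intro nn_integral_cong) (simp add: indicator_def)

lemma integrable_inner_square:
  fixes f g :: "'a \<Rightarrow> 'v::euclidean_space"
  assumes [measurable]: "f \<in> borel_measurable M" "g \<in> borel_measurable M"
    and "integrable M (\<lambda>s. (norm (f s))\<^sup>2)" "integrable M (\<lambda>s. (norm (g s))\<^sup>2)"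
  shows "integrable M (\<lambda>s. f s \<bullet> g s)"
proof (rule Bochner_Integration.integrable_bound)
  show "integrable M (\<lambda>s. (norm (f s))\<^sup>2 + (norm (g s))\<^sup>2)" using assms by simp
  have "\<bar>f s \<bullet> g s\<bar> \<le> (norm (f s))\<^sup>2 + (norm (g s))\<^sup>2" for s
  proof -
    have "\<bar>f s \<bullet> g s\<bar> \<le> norm (f s) * norm (g s)" by (rule Cauchy_Schwarz_ineq2)
    also have "\<dots> \<le> 2 * norm (f s) * norm (g s)" by simp
    also have "\<dots> \<le> (norm (f s))\<^sup>2 + (norm (g s))\<^sup>2" by (rule sum_squares_bound)
    finally show ?thesis .
  qed
  then show "AE s in M. norm (f s \<bullet> g s) \<le> norm ((norm (f s))\<^sup>2 + (norm (g s))\<^sup>2)" by simp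
qed simp

lemma norm2_add_expand:
  fixes x y :: "'v::real_inner"
  shows "(norm (a *\<^sub>R x + b *\<^sub>R y))\<^sup>2 = a\<^sup>2 * (norm x)\<^sup>2 + 2 * a * b * (x \<bullet> y) + b\<^sup>2 * (norm y)\<^sup>2"
  by (simp only: power2_norm_eq_inner) (simp add: inner_add_left inner_add_right inner_commute power2_eq_square algebra_simps)

text \<open>The mixed term of this expansion later becomes the covariance of two Wiener
  integrals.\<close>

lemma square_integrable_on_linear:
  fixes f g :: "real \<Rightarrow> 'v::euclidean_space"
  assumes f: "square_integrable_on A f" and g: "square_integrable_on A g" and A[measurable]: "A \<in> sets borel"
  shows "square_integrable_on A (\<lambda>s. a *\<^sub>R f s + b *\<^sub>R g s)"
    and "(LINT s:A|lborel. (norm (a *\<^sub>R f s + b *\<^sub>R g s))\<^sup>2) =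
      a\<^sup>2 * (LINT s:A|lborel. (norm (f s))\<^sup>2) + 2 * a * b * (LINT s:A|lborel. f s \<bullet> g s) + b\<^sup>2 * (LINT s:A|lborel. (norm (g s))\<^sup>2)"
proof -
  define f' where "f' s = indicator A s *\<^sub>R f s" for s
  define g' where "g' s = indicator A s *\<^sub>R g s" for s
  note F = square_integrable_onD[OF f, folded f'_def] and G = square_integrable_onD[OF g, folded g'_def]
  note [measurable] = F(1) G(1)
  have I: "integrable lborel (\<lambda>s. f' s \<bullet> g' s)"
    by (rule integrable_inner_square) (use F G in auto)
  have lin: "indicator A s *\<^sub>R (a *\<^sub>R f s + b *\<^sub>R g s) = a *\<^sub>R f' s + b *\<^sub>R g' s" for s
    by (simp add: indicator_def f'_def g'_def)
  show *: "square_integrable_on A (\<lambda>s. a *\<^sub>R f s + b *\<^sub>R g s)"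
  proof (rule square_integrable_onI; unfold lin)
    show "integrable lborel (\<lambda>s. (norm (a *\<^sub>R f' s + b *\<^sub>R g' s))\<^sup>2)"
      unfolding norm2_add_expand
      by (intro Bochner_Integration.integrable_add integrable_mult_right F(2) G(2) I)
  qed measurable
  have "(LINT s:A|lborel. f s \<bullet> g s) = (LINT s|lborel. f' s \<bullet> g' s)"
    unfolding set_lebesgue_integral_def
    by (intro Bochner_Integration.integral_cong) (auto simp: indicator_def f'_def g'_def)
  moreover have "(LINT s:A|lborel. (norm (a *\<^sub>R f s + b *\<^sub>R g s))\<^sup>2) =
      a\<^sup>2 * (LINT s|lborel. (norm (f' s))\<^sup>2) + 2 * a * b * (LINT s|lborel. f' s \<bullet> g' s) + b\<^sup>2 * (LINT s|lborel. (norm (g' s))\<^sup>2)"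
    unfolding square_integrable_onD(3)[OF *] unfolding lin norm2_add_expand using F(2) G(2) I by simp
  ultimately show "(LINT s:A|lborel. (norm (a *\<^sub>R f s + b *\<^sub>R g s))\<^sup>2) =
      a\<^sup>2 * (LINT s:A|lborel. (norm (f s))\<^sup>2) + 2 * a * b * (LINT s:A|lborel. f s \<bullet> g s) + b\<^sup>2 * (LINT s:A|lborel. (norm (g s))\<^sup>2)"
    by (simp only: F(3) G(3))
qed

section \<open>Mean-square limits\<close>

text \<open>Triangle inequality, then Young's inequality with weight \<open>sqrt \<epsilon>\<close>
  on the cross term. The coefficient of \<open>(norm y)\<^sup>2\<close> comes as close to 1 as
  desired at the expense of the distance term, and the estimate can be integrated without taking
  roots.\<close>

lemma norm2_le_eps:
  fixes x y :: "'v::real_inner"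
  assumes "0 < \<epsilon>"
  shows "(norm x)\<^sup>2 \<le> (1 + \<epsilon>) * (norm y)\<^sup>2 + (1 + 1 / \<epsilon>) * (norm (x - y))\<^sup>2"
proof -
  have "(norm x)\<^sup>2 \<le> (norm y + norm (x - y))\<^sup>2"
    using norm_triangle_ineq[of y "x - y"] by (intro power_mono) auto
  also have "\<dots> = (norm y)\<^sup>2 + (norm (x - y))\<^sup>2 + 2 * (sqrt \<epsilon> * norm y) * (norm (x - y) / sqrt \<epsilon>)"
    using assms by (simp add: power2_sum)
  also have "2 * (sqrt \<epsilon> * norm y) * (norm (x - y) / sqrt \<epsilon>) \<le> (sqrt \<epsilon> * norm y)\<^sup>2 + (norm (x - y) / sqrt \<epsilon>)\<^sup>2"
    by (rule sum_squares_bound)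
  also have "\<dots> = \<epsilon> * (norm y)\<^sup>2 + (1 / \<epsilon>) * (norm (x - y))\<^sup>2"
    using assms by (simp add: power_mult_distrib power_divide)
  finally show ?thesis by (simp add: algebra_simps)
qed

lemma nn_integral_norm2_le_eps:
  fixes f g :: "'a \<Rightarrow> 'v::euclidean_space"
  assumes [measurable]: "f \<in> borel_measurable M" "g \<in> borel_measurable M" and \<epsilon>: "0 < \<epsilon>"
    and f: "(\<integral>\<^sup>+x. ennreal ((norm (f x))\<^sup>2) \<partial>M) = ennreal a" "0 \<le> a"
    and g: "(\<integral>\<^sup>+x. ennreal ((norm (g x))\<^sup>2) \<partial>M) = ennreal b" "0 \<le> b"
    and d: "(\<integral>\<^sup>+x. ennreal ((norm (f x - g x))\<^sup>2) \<partial>M) \<le> ennreal \<delta>" "0 \<le> \<delta>"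
  shows "a \<le> (1 + \<epsilon>) * b + (1 + 1 / \<epsilon>) * \<delta>"
proof -
  have "ennreal a \<le> (\<integral>\<^sup>+x. ennreal (1 + \<epsilon>) * ennreal ((norm (g x))\<^sup>2) + ennreal (1 + 1 / \<epsilon>) * ennreal ((norm (f x - g x))\<^sup>2) \<partial>M)"
    unfolding f(1)[symmetric]
    using \<epsilon> by (intro nn_integral_mono) (simp add: norm2_le_eps flip: ennreal_mult ennreal_plus)
  also have "\<dots> = ennreal (1 + \<epsilon>) * ennreal b + ennreal (1 + 1 / \<epsilon>) * (\<integral>\<^sup>+x. ennreal ((norm (f x - g x))\<^sup>2) \<partial>M)"
    by (simp add: nn_integral_add nn_integral_cmult g(1))
  also have "\<dots> \<le> ennreal (1 + \<epsilon>) * ennreal b + ennreal (1 + 1 / \<epsilon>) * ennreal \<delta>"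
    by (intro add_left_mono mult_left_mono d) simp
  also have "\<dots> = ennreal ((1 + \<epsilon>) * b + (1 + 1 / \<epsilon>) * \<delta>)"
    using \<epsilon> g(2) d(2) by (simp flip: ennreal_mult ennreal_plus)
  finally show ?thesis using \<epsilon> g(2) d(2) by (subst (asm) ennreal_le_iff) auto
qed

text \<open>Continuity of the squared L2 norm: the preceding inequality, used in both directions
  with \<open>\<delta> = \<epsilon>\<^sup>2\<close>, plays the part of the reverse triangle
  inequality.\<close>

lemma nn_integral_norm2_tendsto:
  fixes f :: "'a \<Rightarrow> 'v::euclidean_space"
  assumes [measurable]: "f \<in> borel_measurable M" "\<And>k. g k \<in> borel_measurable M"
    and f: "(\<integral>\<^sup>+x. ennreal ((norm (f x))\<^sup>2) \<partial>M) = ennreal a" "0 \<le> a"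
    and g: "\<And>k. (\<integral>\<^sup>+x. ennreal ((norm (g k x))\<^sup>2) \<partial>M) = ennreal (b k)" "\<And>k. 0 \<le> b k"
    and lim: "(\<lambda>k. \<integral>\<^sup>+x. ennreal ((norm (f x - g k x))\<^sup>2) \<partial>M) \<longlonglongrightarrow> 0"
  shows "b \<longlonglongrightarrow> a"
proof (rule LIMSEQ_I)
  fix r :: real assume r: "0 < r"
  \<comment> \<open>The remainder is
    \<open>\<epsilon>\<^sup>2 + \<epsilon> \<le> 2 * \<epsilon>\<close>, and
    \<open>b k \<le> 2 * a + 2\<close>, so \<open>a - b k \<le> \<epsilon> * (2 * a + 4)\<close>;
    the summand 5 makes the bound strict.\<close>
  define \<epsilon> where "\<epsilon> = min 1 (r / (2 * a + 5))"
  have \<epsilon>: "0 < \<epsilon>" "\<epsilon> \<le> 1" "\<epsilon> * (2 * a + 5) \<le> r"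
  proof -
    show "0 < \<epsilon>" "\<epsilon> \<le> 1" using r f(2) by (auto simp: \<epsilon>_def)
    have "\<epsilon> \<le> r / (2 * a + 5)" by (simp add: \<epsilon>_def)
    then show "\<epsilon> * (2 * a + 5) \<le> r" using f(2) by (subst (asm) pos_le_divide_eq) auto
  qed
  have "\<forall>\<^sub>F k in sequentially. (\<integral>\<^sup>+x. ennreal ((norm (f x - g k x))\<^sup>2) \<partial>M) < ennreal (\<epsilon>\<^sup>2)"
    using order_tendstoD(2)[OF lim, of "ennreal (\<epsilon>\<^sup>2)"] \<epsilon> by simp
  then obtain N where N: "\<And>k. N \<le> k \<Longrightarrow> (\<integral>\<^sup>+x. ennreal ((norm (f x - g k x))\<^sup>2) \<partial>M) \<le> ennreal (\<epsilon>\<^sup>2)"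
    unfolding eventually_sequentially using less_imp_le by blast
  have "norm (b k - a) < r" if "N \<le> k" for k
  proof -
    have rem: "(1 + 1 / \<epsilon>) * \<epsilon>\<^sup>2 = \<epsilon>\<^sup>2 + \<epsilon>" using \<epsilon> by (simp add: field_simps power2_eq_square)
    have "a \<le> (1 + \<epsilon>) * b k + (1 + 1 / \<epsilon>) * \<epsilon>\<^sup>2"
      by (rule nn_integral_norm2_le_eps[OF _ _ \<epsilon>(1) f g(1) g(2) N[OF that]]) auto
    moreover have "b k \<le> (1 + \<epsilon>) * a + (1 + 1 / \<epsilon>) * \<epsilon>\<^sup>2"
      by (rule nn_integral_norm2_le_eps[OF _ _ \<epsilon>(1) g(1) g(2) f]) (use N[OF that] in \<open>auto simp: norm_minus_commute\<close>)
    moreover have \<epsilon>2: "\<epsilon>\<^sup>2 \<le> \<epsilon>" using \<epsilon> by (simp add: power2_eq_square mult_left_le)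
    moreover have "\<epsilon> * b k \<le> \<epsilon> * (2 * a + 2)"
    proof (rule mult_left_mono)
      have "(1 + \<epsilon>) * a \<le> 2 * a" using \<epsilon> f(2) by (intro mult_right_mono) auto
      with \<open>b k \<le> (1 + \<epsilon>) * a + (1 + 1 / \<epsilon>) * \<epsilon>\<^sup>2\<close> \<epsilon> \<epsilon>2 show "b k \<le> 2 * a + 2" unfolding rem by linarith
    qed (use \<epsilon> in auto)
    moreover have "0 \<le> \<epsilon> * a" "0 < \<epsilon>" using \<epsilon> f(2) by auto
    ultimately show ?thesis using \<epsilon>(3) unfolding rem by (simp add: algebra_simps abs_less_iff)
  qed
  then show "\<exists>N. \<forall>k\<ge>N. norm (b k - a) < r" by blast
qed

lemma norm_iexp_diff_le: "norm (iexp a - iexp b) \<le> \<bar>a - b\<bar>"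
proof -
  have "iexp a - iexp b = iexp b * (iexp (a - b) - 1)"
    by (simp add: algebra_simps flip: exp_add)
  then have "norm (iexp a - iexp b) = norm (iexp (a - b) - 1)" by (simp add: norm_mult)
  also have "\<dots> \<le> \<bar>a - b\<bar>" using iexp_approx1[of "a - b" 0] by simp
  finally show ?thesis .
qed

text \<open>As \<open>iexp\<close> is 1-Lipschitz, the difference is at most
  \<open>\<bar>u\<bar>\<close> times the mean of \<open>\<bar>X - Y k\<bar>\<close>, which
  Cauchy-Schwarz bounds by the L2 distance. The estimate is squared so that it can be carried out in
  \<open>ennreal\<close> without roots.\<close>

lemma (in prob_space) char_tendsto_L2:
  assumes [measurable]: "X \<in> borel_measurable M" "\<And>k. Y k \<in> borel_measurable M"
    and lim: "(\<lambda>k. \<integral>\<^sup>+\<omega>. ennreal ((X \<omega> - Y k \<omega>)\<^sup>2) \<partial>M) \<longlonglongrightarrow> 0"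
  shows "(\<lambda>k. char (distr M borel (Y k)) u) \<longlonglongrightarrow> char (distr M borel X) u"
proof -
  let ?D = "\<lambda>k. char (distr M borel X) u - char (distr M borel (Y k)) u"
  have i: "integrable M (\<lambda>\<omega>. iexp (u * X \<omega>))" "integrable M (\<lambda>\<omega>. iexp (u * Y k \<omega>))" for k
    by (rule integrable_const_bound[of _ 1]; simp)+
  have le: "ennreal ((norm (?D k))\<^sup>2) \<le> ennreal (u\<^sup>2) * (\<integral>\<^sup>+\<omega>. ennreal ((X \<omega> - Y k \<omega>)\<^sup>2) \<partial>M)" for k
  proof -
    have "?D k = (LINT \<omega>|M. iexp (u * X \<omega>) - iexp (u * Y k \<omega>))"
      by (subst Bochner_Integration.integral_diff[OF i]) (simp add: char_def integral_distr)
    also have "ennreal (norm \<dots>) \<le> (\<integral>\<^sup>+\<omega>. ennreal (norm (iexp (u * X \<omega>) - iexp (u * Y k \<omega>))) \<partial>M)"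
      by (rule integral_norm_bound_ennreal) (use i in auto)
    \<comment> \<open>The factor 1 is the second function in Cauchy-Schwarz; its squared integral is
      the total mass 1.\<close>
    finally have "(ennreal (norm (?D k)))\<^sup>2 \<le> (\<integral>\<^sup>+\<omega>. ennreal (norm (iexp (u * X \<omega>) - iexp (u * Y k \<omega>))) * 1 \<partial>M)\<^sup>2"
      by (intro power_mono) auto
    also have "\<dots> \<le> (\<integral>\<^sup>+\<omega>. (ennreal (norm (iexp (u * X \<omega>) - iexp (u * Y k \<omega>))))\<^sup>2 \<partial>M) * (\<integral>\<^sup>+\<omega>. 1\<^sup>2 \<partial>M)"
      by (rule Cauchy_Schwarz_nn_integral) auto
    also have "\<dots> = (\<integral>\<^sup>+\<omega>. ennreal ((norm (iexp (u * X \<omega>) - iexp (u * Y k \<omega>)))\<^sup>2) \<partial>M)"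
      by (simp add: emeasure_space_1 ennreal_power)
    also have "\<dots> \<le> (\<integral>\<^sup>+\<omega>. ennreal (u\<^sup>2 * (X \<omega> - Y k \<omega>)\<^sup>2) \<partial>M)"
    proof (intro nn_integral_mono ennreal_leI)
      fix \<omega>
      have "norm (iexp (u * X \<omega>) - iexp (u * Y k \<omega>)) \<le> \<bar>u * (X \<omega> - Y k \<omega>)\<bar>"
        using norm_iexp_diff_le[of "u * X \<omega>" "u * Y k \<omega>"] by (simp add: right_diff_distrib)
      then have "(norm (iexp (u * X \<omega>) - iexp (u * Y k \<omega>)))\<^sup>2 \<le> \<bar>u * (X \<omega> - Y k \<omega>)\<bar>\<^sup>2"
        by (intro power_mono) auto
      then show "(norm (iexp (u * X \<omega>) - iexp (u * Y k \<omega>)))\<^sup>2 \<le> u\<^sup>2 * (X \<omega> - Y k \<omega>)\<^sup>2"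
        by (simp add: power_mult_distrib)
    qed
    also have "\<dots> = ennreal (u\<^sup>2) * (\<integral>\<^sup>+\<omega>. ennreal ((X \<omega> - Y k \<omega>)\<^sup>2) \<partial>M)"
      by (simp add: ennreal_mult nn_integral_cmult)
    finally show ?thesis by (simp add: ennreal_power)
  qed
  have "(\<lambda>k. ennreal ((norm (?D k))\<^sup>2)) \<longlonglongrightarrow> 0"
  proof (rule tendsto_sandwich[OF _ _ tendsto_const])
    show "(\<lambda>k. ennreal (u\<^sup>2) * (\<integral>\<^sup>+\<omega>. ennreal ((X \<omega> - Y k \<omega>)\<^sup>2) \<partial>M)) \<longlonglongrightarrow> 0"
      using ennreal_tendsto_cmult[OF _ lim, of "ennreal (u\<^sup>2)"] by simp
  qed (use le in auto)
  then have "(\<lambda>k. (norm (?D k))\<^sup>2) \<longlonglongrightarrow> 0"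
    by (simp add: ennreal_0[symmetric] del: ennreal_0)
  then have "(\<lambda>k. norm (?D k)) \<longlonglongrightarrow> 0"
    using tendsto_real_sqrt[of "\<lambda>k. (norm (?D k))\<^sup>2" 0] by simp
  then have "(\<lambda>k. char (distr M borel X) u - ?D k) \<longlonglongrightarrow> char (distr M borel X) u - 0"
    by (intro tendsto_intros) (simp add: tendsto_norm_zero_iff)
  then show ?thesis by simp
qed

lemma measurable_step_function[measurable]: "step_function ps \<in> borel_measurable borel"
  unfolding step_function_def[abs_def]
proof (induction ps)
  case (Cons p ps)
  then show ?case by (cases p) simp
qed simp

lemma measurable_step_integral:
  fixes W :: "real \<Rightarrow> 'a \<Rightarrow> 'v::euclidean_space"
  assumes W: "\<And>s. 0 \<le> s \<Longrightarrow> s \<le> t \<Longrightarrow> W s \<in> borel_measurable M"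
    and ps: "\<forall>(a, b, c)\<in>set ps. 0 \<le> a \<and> a \<le> b \<and> b \<le> t"
  shows "step_integral W ps \<in> borel_measurable M"
  using ps unfolding step_integral_def[abs_def]
proof (induction ps)
  case (Cons p ps)
  obtain a b v where p: "p = (a, b, v)" by (cases p)
  have [measurable]: "W a \<in> borel_measurable M" "W b \<in> borel_measurable M"
    using Cons.prems by (auto simp: p intro!: W)
  show ?case using Cons by (simp add: p)
qed simp

text \<open>One sequence of step functions witnesses both limits in the definition: convergence of
  the integrands moves the variances \<open>q k\<close> to the squared norm of \<open>f\<close>,
  convergence of the integrals moves the characteristic functions.\<close>

lemma char_wiener_integral:
  fixes W :: "real \<Rightarrow> 'a \<Rightarrow> real ^ 'n"
  assumes BM: "brownian_motion_on M T W" and t: "0 \<le> t" "t \<le> T"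
    and f: "square_integrable_on {0..t} f" and X: "has_wiener_integral M W t f X"
  shows "char (distr M borel X) u = exp (- u\<^sup>2 * (LINT s:{0..t}|lborel. (norm (f s))\<^sup>2) / 2)"
proof -
  interpret prob_space M using BM by (rule brownian_motion_onD)
  obtain ps where ps: "\<And>k. \<forall>(a, b, c)\<in>set (ps k). 0 \<le> a \<and> a \<le> b \<and> b \<le> t"
    and lim_f: "(\<lambda>k. \<integral>\<^sup>+s\<in>{0..t}. ennreal ((norm (f s - step_function (ps k) s))\<^sup>2) \<partial>lborel) \<longlonglongrightarrow> 0"
    and lim_X: "(\<lambda>k. \<integral>\<^sup>+\<omega>. ennreal ((X \<omega> - step_integral W (ps k) \<omega>)\<^sup>2) \<partial>M) \<longlonglongrightarrow> 0"
    and [measurable]: "X \<in> borel_measurable M"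
    using X unfolding has_wiener_integral_def by blast
  have "\<forall>k. \<exists>q\<ge>0. (\<integral>\<^sup>+r\<in>{0..t}. ennreal ((norm (step_function (ps k) r))\<^sup>2) \<partial>lborel) = ennreal q \<and>
    (\<forall>u. char (distr M borel (step_integral W (ps k))) u = exp (- u\<^sup>2 * q / 2))"
    using char_step_integral[OF BM t ps] by blast
  then obtain q where q: "\<And>k. 0 \<le> q k"
    "\<And>k. (\<integral>\<^sup>+r\<in>{0..t}. ennreal ((norm (step_function (ps k) r))\<^sup>2) \<partial>lborel) = ennreal (q k)"
    "\<And>k u. char (distr M borel (step_integral W (ps k))) u = exp (- u\<^sup>2 * q k / 2)"
    by metis
  note F = square_integrable_onD[OF f]
  note [measurable] = F(1)
  let ?I = "LINT s:{0..t}|lborel. (norm (f s))\<^sup>2"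
  have "q \<longlonglongrightarrow> ?I"
  proof (rule nn_integral_norm2_tendsto)
    show "(\<integral>\<^sup>+s. ennreal ((norm (indicator {0..t} s *\<^sub>R f s))\<^sup>2) \<partial>lborel) = ennreal ?I"
      unfolding F(3) by (rule nn_integral_eq_integral[OF F(2)]) simp
    show "0 \<le> ?I" unfolding F(3) by simp
    show "(\<integral>\<^sup>+s. ennreal ((norm (indicator {0..t} s *\<^sub>R step_function (ps k) s))\<^sup>2) \<partial>lborel) = ennreal (q k)" for k
      using q(2)[of k] unfolding set_nn_integral_norm2 .
    show "(\<lambda>k. \<integral>\<^sup>+s. ennreal ((norm (indicator {0..t} s *\<^sub>R f s - indicator {0..t} s *\<^sub>R step_function (ps k) s))\<^sup>2) \<partial>lborel) \<longlonglongrightarrow> 0"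
      using lim_f unfolding set_nn_integral_norm2 by (simp add: scaleR_diff_right)
  qed (use q in auto)
  then have "(\<lambda>k. complex_of_real (exp (- u\<^sup>2 * q k / 2))) \<longlonglongrightarrow> complex_of_real (exp (- u\<^sup>2 * ?I / 2))"
    by (intro tendsto_intros) auto
  moreover have "(\<lambda>k. char (distr M borel (step_integral W (ps k))) u) \<longlonglongrightarrow> char (distr M borel X) u"
  proof (rule char_tendsto_L2[OF _ _ lim_X])
    show "step_integral W (ps k) \<in> borel_measurable M" for k
      by (rule measurable_step_integral[OF _ ps]) (use brownian_motion_onD(2)[OF BM] t in auto)
  qed simp
  ultimately show ?thesis
    unfolding q(3) by (rule LIMSEQ_unique[symmetric])
qed

section \<open>Linearity of the Wiener integral\<close>

lemma step_function_append: "step_function (ps @ qs) s = step_function ps s + step_function qs s"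
  by (simp add: step_function_def)

lemma step_integral_append: "step_integral W (ps @ qs) \<omega> = step_integral W ps \<omega> + step_integral W qs \<omega>"
  by (simp add: step_integral_def)

lemma step_function_scale: "step_function (map (\<lambda>(a, b, c). (a, b, r *\<^sub>R c)) ps) s = r *\<^sub>R step_function ps s"
  by (induction ps) (auto simp: step_function_def scaleR_add_right)

lemma step_integral_scale: "step_integral W (map (\<lambda>(a, b, c). (a, b, r *\<^sub>R c)) ps) \<omega> = r * step_integral W ps \<omega>"
  by (induction ps) (auto simp: step_integral_def distrib_left)

lemma nn_integral_norm2_linear_tendsto_0:
  fixes f g :: "nat \<Rightarrow> 'a \<Rightarrow> 'v::euclidean_space"
  assumes [measurable]: "\<And>k. f k \<in> borel_measurable M" "\<And>k. g k \<in> borel_measurable M"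
    and f: "(\<lambda>k. \<integral>\<^sup>+x. ennreal ((norm (f k x))\<^sup>2) \<partial>M) \<longlonglongrightarrow> 0"
    and g: "(\<lambda>k. \<integral>\<^sup>+x. ennreal ((norm (g k x))\<^sup>2) \<partial>M) \<longlonglongrightarrow> 0"
  shows "(\<lambda>k. \<integral>\<^sup>+x. ennreal ((norm (a *\<^sub>R f k x + b *\<^sub>R g k x))\<^sup>2) \<partial>M) \<longlonglongrightarrow> 0"
proof (rule tendsto_sandwich[OF _ _ tendsto_const])
  have "(norm (a *\<^sub>R x + b *\<^sub>R y))\<^sup>2 \<le> 2 * a\<^sup>2 * (norm x)\<^sup>2 + 2 * b\<^sup>2 * (norm y)\<^sup>2" for x y :: 'v
  proof -
    have "2 * a * b * (x \<bullet> y) = 2 * ((a *\<^sub>R x) \<bullet> (b *\<^sub>R y))" by simp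
    also have "\<dots> \<le> 2 * norm (a *\<^sub>R x) * norm (b *\<^sub>R y)" using norm_cauchy_schwarz[of "a *\<^sub>R x" "b *\<^sub>R y"] by linarith
    also have "\<dots> \<le> (norm (a *\<^sub>R x))\<^sup>2 + (norm (b *\<^sub>R y))\<^sup>2" by (rule sum_squares_bound)
    also have "\<dots> = a\<^sup>2 * (norm x)\<^sup>2 + b\<^sup>2 * (norm y)\<^sup>2" by (simp add: power_mult_distrib)
    finally show ?thesis unfolding norm2_add_expand by simp
  qed
  then have "(\<integral>\<^sup>+x. ennreal ((norm (a *\<^sub>R f k x + b *\<^sub>R g k x))\<^sup>2) \<partial>M)
      \<le> (\<integral>\<^sup>+x. ennreal (2 * a\<^sup>2) * ennreal ((norm (f k x))\<^sup>2) + ennreal (2 * b\<^sup>2) * ennreal ((norm (g k x))\<^sup>2) \<partial>M)" for k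
    by (intro nn_integral_mono) (simp flip: ennreal_mult ennreal_plus)
  also have "(\<integral>\<^sup>+x. ennreal (2 * a\<^sup>2) * ennreal ((norm (f k x))\<^sup>2) + ennreal (2 * b\<^sup>2) * ennreal ((norm (g k x))\<^sup>2) \<partial>M)
      = ennreal (2 * a\<^sup>2) * (\<integral>\<^sup>+x. ennreal ((norm (f k x))\<^sup>2) \<partial>M) + ennreal (2 * b\<^sup>2) * (\<integral>\<^sup>+x. ennreal ((norm (g k x))\<^sup>2) \<partial>M)" for k
    by (simp add: nn_integral_add nn_integral_cmult)
  finally show "\<forall>\<^sub>F k in sequentially. (\<integral>\<^sup>+x. ennreal ((norm (a *\<^sub>R f k x + b *\<^sub>R g k x))\<^sup>2) \<partial>M)
      \<le> ennreal (2 * a\<^sup>2) * (\<integral>\<^sup>+x. ennreal ((norm (f k x))\<^sup>2) \<partial>M) + ennreal (2 * b\<^sup>2) * (\<integral>\<^sup>+x. ennreal ((norm (g k x))\<^sup>2) \<partial>M)"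
    by simp
  show "(\<lambda>k. ennreal (2 * a\<^sup>2) * (\<integral>\<^sup>+x. ennreal ((norm (f k x))\<^sup>2) \<partial>M) + ennreal (2 * b\<^sup>2) * (\<integral>\<^sup>+x. ennreal ((norm (g k x))\<^sup>2) \<partial>M)) \<longlonglongrightarrow> 0"
    using tendsto_add[OF ennreal_tendsto_cmult[OF _ f, of "ennreal (2 * a\<^sup>2)"] ennreal_tendsto_cmult[OF _ g, of "ennreal (2 * b\<^sup>2)"]]
    by simp
qed simp

text \<open>Concatenating lists adds step functions as well as their integrals, overlaps being
  permitted, so the scaled approximating sequences of \<open>f\<close> and \<open>g\<close> combine
  termwise.\<close>

lemma has_wiener_integral_linear:
  fixes W :: "real \<Rightarrow> 'a \<Rightarrow> 'v::euclidean_space"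
  assumes W: "\<And>s. 0 \<le> s \<Longrightarrow> s \<le> t \<Longrightarrow> W s \<in> borel_measurable M"
    and f: "square_integrable_on {0..t} f" and g: "square_integrable_on {0..t} g"
    and X: "has_wiener_integral M W t f X" and Y: "has_wiener_integral M W t g Y"
  shows "has_wiener_integral M W t (\<lambda>s. \<alpha> *\<^sub>R f s + \<beta> *\<^sub>R g s) (\<lambda>\<omega>. \<alpha> * X \<omega> + \<beta> * Y \<omega>)"
proof -
  obtain ps where ps: "\<And>k. \<forall>(a, b, c)\<in>set (ps k). 0 \<le> a \<and> a \<le> b \<and> b \<le> t"
    and lim_f: "(\<lambda>k. \<integral>\<^sup>+s\<in>{0..t}. ennreal ((norm (f s - step_function (ps k) s))\<^sup>2) \<partial>lborel) \<longlonglongrightarrow> 0"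
    and lim_X: "(\<lambda>k. \<integral>\<^sup>+\<omega>. ennreal ((X \<omega> - step_integral W (ps k) \<omega>)\<^sup>2) \<partial>M) \<longlonglongrightarrow> 0"
    and [measurable]: "X \<in> borel_measurable M"
    using X unfolding has_wiener_integral_def by blast
  obtain qs where qs: "\<And>k. \<forall>(a, b, c)\<in>set (qs k). 0 \<le> a \<and> a \<le> b \<and> b \<le> t"
    and lim_g: "(\<lambda>k. \<integral>\<^sup>+s\<in>{0..t}. ennreal ((norm (g s - step_function (qs k) s))\<^sup>2) \<partial>lborel) \<longlonglongrightarrow> 0"
    and lim_Y: "(\<lambda>k. \<integral>\<^sup>+\<omega>. ennreal ((Y \<omega> - step_integral W (qs k) \<omega>)\<^sup>2) \<partial>M) \<longlonglongrightarrow> 0"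
    and [measurable]: "Y \<in> borel_measurable M"
    using Y unfolding has_wiener_integral_def by blast
  note [measurable] = square_integrable_onD(1)[OF f] square_integrable_onD(1)[OF g]
    measurable_step_integral[OF W ps] measurable_step_integral[OF W qs]
  define rs where "rs k = map (\<lambda>(a, b, c). (a, b, \<alpha> *\<^sub>R c)) (ps k) @ map (\<lambda>(a, b, c). (a, b, \<beta> *\<^sub>R c)) (qs k)" for k
  have rs_f: "step_function (rs k) s = \<alpha> *\<^sub>R step_function (ps k) s + \<beta> *\<^sub>R step_function (qs k) s" for k s
    by (simp add: rs_def step_function_append step_function_scale)
  have rs_i: "step_integral W (rs k) \<omega> = \<alpha> * step_integral W (ps k) \<omega> + \<beta> * step_integral W (qs k) \<omega>" for k \<omega>
    by (simp add: rs_def step_integral_append step_integral_scale)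
  show ?thesis
    unfolding has_wiener_integral_def
  proof (intro conjI exI[of _ rs] allI)
    show "\<forall>(a, b, c)\<in>set (rs k). 0 \<le> a \<and> a \<le> b \<and> b \<le> t" for k
      using ps[of k] qs[of k] by (fastforce simp: rs_def)
    have "(\<lambda>k. \<integral>\<^sup>+s. ennreal ((norm (\<alpha> *\<^sub>R (indicator {0..t} s *\<^sub>R (f s - step_function (ps k) s)) + \<beta> *\<^sub>R (indicator {0..t} s *\<^sub>R (g s - step_function (qs k) s))))\<^sup>2) \<partial>lborel) \<longlonglongrightarrow> 0"
      by (rule nn_integral_norm2_linear_tendsto_0)
         (use lim_f lim_g in \<open>simp_all only: set_nn_integral_norm2, simp_all add: scaleR_diff_right\<close>)
    also have "(\<lambda>k. \<integral>\<^sup>+s. ennreal ((norm (\<alpha> *\<^sub>R (indicator {0..t} s *\<^sub>R (f s - step_function (ps k) s)) + \<beta> *\<^sub>R (indicator {0..t} s *\<^sub>R (g s - step_function (qs k) s))))\<^sup>2) \<partial>lborel)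
        = (\<lambda>k. \<integral>\<^sup>+s\<in>{0..t}. ennreal ((norm (\<alpha> *\<^sub>R f s + \<beta> *\<^sub>R g s - step_function (rs k) s))\<^sup>2) \<partial>lborel)"
      unfolding set_nn_integral_norm2 rs_f by (simp add: algebra_simps)
    finally show "(\<lambda>k. \<integral>\<^sup>+s\<in>{0..t}. ennreal ((norm (\<alpha> *\<^sub>R f s + \<beta> *\<^sub>R g s - step_function (rs k) s))\<^sup>2) \<partial>lborel) \<longlonglongrightarrow> 0" .
    have "(\<lambda>k. \<integral>\<^sup>+\<omega>. ennreal ((norm (\<alpha> *\<^sub>R (X \<omega> - step_integral W (ps k) \<omega>) + \<beta> *\<^sub>R (Y \<omega> - step_integral W (qs k) \<omega>)))\<^sup>2) \<partial>M) \<longlonglongrightarrow> 0"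
      by (rule nn_integral_norm2_linear_tendsto_0) (use lim_X lim_Y in simp_all)
    then show "(\<lambda>k. \<integral>\<^sup>+\<omega>. ennreal ((\<alpha> * X \<omega> + \<beta> * Y \<omega> - step_integral W (rs k) \<omega>)\<^sup>2) \<partial>M) \<longlonglongrightarrow> 0"
      unfolding rs_i by (simp add: algebra_simps)
  qed simp
qed

section \<open>Exponential change of measure\<close>

text \<open>Under independence the joint law is a product, and Tonelli applies. Values in
  \<open>ennreal\<close> admit exponential weights whose expectation might be infinite.\<close>

lemma (in prob_space) indep_var_nn_integral_mult:
  assumes indep: "indep_var S X T Y"
    and g[measurable]: "g \<in> borel_measurable S" and h[measurable]: "h \<in> borel_measurable T"
  shows "(\<integral>\<^sup>+\<omega>. g (X \<omega>) * h (Y \<omega>) \<partial>M) = (\<integral>\<^sup>+\<omega>. g (X \<omega>) \<partial>M) * (\<integral>\<^sup>+\<omega>. h (Y \<omega>) \<partial>M)"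
proof -
  have [measurable]: "random_variable S X" "random_variable T Y"
    using indep by (auto dest: indep_var_rv1 indep_var_rv2)
  interpret X: prob_space "distr M S X" by (rule prob_space_distr) simp
  interpret Y: prob_space "distr M T Y" by (rule prob_space_distr) simp
  have "(\<integral>\<^sup>+\<omega>. g (X \<omega>) * h (Y \<omega>) \<partial>M)
      = (\<integral>\<^sup>+z. g (fst z) * h (snd z) \<partial>distr M (S \<Otimes>\<^sub>M T) (\<lambda>\<omega>. (X \<omega>, Y \<omega>)))"
    by (simp add: nn_integral_distr)
  also have "distr M (S \<Otimes>\<^sub>M T) (\<lambda>\<omega>. (X \<omega>, Y \<omega>)) = distr M S X \<Otimes>\<^sub>M distr M T Y"
    using indep by (simp add: indep_var_distribution_eq)
  also have "(\<integral>\<^sup>+z. g (fst z) * h (snd z) \<partial>(distr M S X \<Otimes>\<^sub>M distr M T Y))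
      = (\<integral>\<^sup>+x. (\<integral>\<^sup>+y. g x * h y \<partial>distr M T Y) \<partial>distr M S X)"
    by (subst Y.nn_integral_fst[symmetric]) simp_all
  also have "\<dots> = (\<integral>\<^sup>+\<omega>. g (X \<omega>) \<partial>M) * (\<integral>\<^sup>+\<omega>. h (Y \<omega>) \<partial>M)"
    by (simp add: nn_integral_cmult nn_integral_multc nn_integral_distr)
  finally show ?thesis .
qed

text \<open>Completing the square. The constant is the moment generating function of the centred
  normal law at \<open>- a\<close>.\<close>

lemma normal_density_exp_tilt:
  assumes "0 < \<sigma>"
  shows "exp (- a * x) * normal_density 0 \<sigma> x = exp (a\<^sup>2 * \<sigma>\<^sup>2 / 2) * normal_density (- a * \<sigma>\<^sup>2) \<sigma> x"
proof -
  have "- a * x + (- x\<^sup>2 / (2 * \<sigma>\<^sup>2)) = a\<^sup>2 * \<sigma>\<^sup>2 / 2 + (- (x + a * \<sigma>\<^sup>2)\<^sup>2 / (2 * \<sigma>\<^sup>2))"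
    using assms by (simp add: field_simps power2_eq_square)
  then have "exp (- a * x) * exp (- x\<^sup>2 / (2 * \<sigma>\<^sup>2)) = exp (a\<^sup>2 * \<sigma>\<^sup>2 / 2) * exp (- (x + a * \<sigma>\<^sup>2)\<^sup>2 / (2 * \<sigma>\<^sup>2))"
    by (simp only: exp_add[symmetric])
  then show ?thesis by (simp add: normal_density_def)
qed

text \<open>The component \<open>I - (\<rho>/\<sigma>\<^sup>2) X\<close> of \<open>I\<close> is independent of \<open>X\<close>, so it only contributes a constant
  factor to the density of \<open>X\<close>; the normalisation of the new measure determines this factor.\<close>

lemma (in prob_space) gaussian_exp_tilt:
  assumes X[measurable]: "X \<in> borel_measurable M" and I[measurable]: "I \<in> borel_measurable M" and \<sigma>: "0 < \<sigma>"
    and joint: "\<And>u v. (LINT \<omega>|M. iexp (u * X \<omega> + v * I \<omega>))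
      = exp (- (u\<^sup>2 * \<sigma>\<^sup>2 + 2 * u * v * \<rho> + v\<^sup>2 * \<tau>) / 2)"
    and norm: "(\<integral>\<^sup>+\<omega>. ennreal (exp (- I \<omega> - c)) \<partial>M) = 1"
  shows "distr (density M (\<lambda>\<omega>. exp (- I \<omega> - c))) borel X = density lborel (normal_density (- \<rho>) \<sigma>)"
proof -
  \<comment> \<open>The regression coefficient of \<open>I\<close> on \<open>X\<close>:
    \<open>\<rho>\<close> is their covariance and \<open>\<sigma>\<^sup>2\<close> the variance of
    \<open>X\<close>, so \<open>I - a X\<close> is uncorrelated with \<open>X\<close>.\<close>
  define a where "a = \<rho> / \<sigma>\<^sup>2"
  have a\<sigma>: "a * \<sigma>\<^sup>2 = \<rho>" using \<sigma> by (simp add: a_def)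
  define R where "R \<omega> = I \<omega> - a * X \<omega>" for \<omega>
  have [measurable]: "R \<in> borel_measurable M" unfolding R_def[abs_def] by simp
  have XR: "(LINT \<omega>|M. iexp (u * X \<omega> + v * R \<omega>)) = exp (- (u\<^sup>2 * \<sigma>\<^sup>2 + v\<^sup>2 * (\<tau> - a * \<rho>)) / 2)" for u v
  proof -
    have "u * X \<omega> + v * R \<omega> = (u - v * a) * X \<omega> + v * I \<omega>" for \<omega>
      by (simp add: R_def algebra_simps)
    moreover have "(u - v * a)\<^sup>2 * \<sigma>\<^sup>2 + 2 * (u - v * a) * v * \<rho> + v\<^sup>2 * \<tau> = u\<^sup>2 * \<sigma>\<^sup>2 + v\<^sup>2 * (\<tau> - a * \<rho>)"
      unfolding a\<sigma>[symmetric] by (simp add: power2_eq_square algebra_simps)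
    ultimately show ?thesis by (simp only: joint)
  qed
  have "indep_var borel X borel R"
  proof (rule indep_var_char_factor)
    fix u v
    have "(LINT \<omega>|M. iexp (u * X \<omega> + v * R \<omega>)) = exp (- (u\<^sup>2 * \<sigma>\<^sup>2) / 2) * exp (- (v\<^sup>2 * (\<tau> - a * \<rho>)) / 2)"
      unfolding XR exp_add[symmetric] of_real_mult[symmetric] by (simp add: field_simps)
    then show "(LINT \<omega>|M. iexp (u * X \<omega> + v * R \<omega>)) = (LINT \<omega>|M. iexp (u * X \<omega>)) * (LINT \<omega>|M. iexp (v * R \<omega>))"
      using XR[of u 0] XR[of 0 v] by simp
  qed auto
  note indep = indep_var_nn_integral_mult[OF this]
  have law_X: "distr M borel X = density lborel (normal_density 0 \<sigma>)"
  proof (rule Levy_uniqueness)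
    interpret N: prob_space "density lborel (normal_density 0 \<sigma>)"
      by (rule prob_space_normal_density[OF \<sigma>])
    show "real_distribution (density lborel (normal_density 0 \<sigma>))"
      by (simp add: real_distribution_def real_distribution_axioms_def N.prob_space_axioms)
    show "char (distr M borel X) = char (density lborel (normal_density 0 \<sigma>))"
    proof
      fix u
      have "char (distr M borel X) u = (LINT \<omega>|M. iexp (u * X \<omega> + 0 * I \<omega>))"
        unfolding char_def by (subst integral_distr) auto
      then show "char (distr M borel X) u = char (density lborel (normal_density 0 \<sigma>)) u"
        unfolding joint char_normal[OF \<sigma>] by (simp add: power_mult_distrib)
    qed
  qed simp
  \<comment> \<open>\<open>D\<close> might still be infinite here and is never evaluated: taking the
    whole line for \<open>B\<close> in \<open>tilt\<close> shows that the full prefactor equals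
    1.\<close>
  define D where "D = (\<integral>\<^sup>+\<omega>. ennreal (exp (- R \<omega> - c)) \<partial>M)"
  have tilt: "(\<integral>\<^sup>+\<omega>. ennreal (exp (- I \<omega> - c)) * indicator B (X \<omega>) \<partial>M)
      = ennreal (exp (a\<^sup>2 * \<sigma>\<^sup>2 / 2)) * D * emeasure (density lborel (normal_density (- \<rho>) \<sigma>)) B"
    if [measurable]: "B \<in> sets borel" for B
  proof -
    have "(\<integral>\<^sup>+\<omega>. ennreal (exp (- I \<omega> - c)) * indicator B (X \<omega>) \<partial>M)
        = (\<integral>\<^sup>+\<omega>. (ennreal (exp (- a * X \<omega>)) * indicator B (X \<omega>)) * ennreal (exp (- R \<omega> - c)) \<partial>M)"
      by (intro nn_integral_cong)
         (auto simp: R_def indicator_def simp flip: ennreal_mult exp_add)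
    also have "\<dots> = (\<integral>\<^sup>+\<omega>. ennreal (exp (- a * X \<omega>)) * indicator B (X \<omega>) \<partial>M) * D"
      unfolding D_def
      by (rule indep[of "\<lambda>x. ennreal (exp (- a * x)) * indicator B x" "\<lambda>r. ennreal (exp (- r - c))"]) measurable
    also have "(\<integral>\<^sup>+\<omega>. ennreal (exp (- a * X \<omega>)) * indicator B (X \<omega>) \<partial>M)
        = (\<integral>\<^sup>+x. ennreal (exp (- a * x)) * indicator B x \<partial>distr M borel X)"
      by (subst nn_integral_distr) auto
    also have "\<dots> = (\<integral>\<^sup>+x. ennreal (normal_density 0 \<sigma> x) * (ennreal (exp (- a * x)) * indicator B x) \<partial>lborel)"
      unfolding law_X by (rule nn_integral_density) auto
    also have "\<dots> = (\<integral>\<^sup>+x. ennreal (exp (a\<^sup>2 * \<sigma>\<^sup>2 / 2)) * (ennreal (normal_density (- \<rho>) \<sigma> x) * indicator B x) \<partial>lborel)"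
    proof (rule nn_integral_cong)
      fix x
      have "ennreal (exp (- a * x)) * ennreal (normal_density 0 \<sigma> x) = ennreal (exp (a\<^sup>2 * \<sigma>\<^sup>2 / 2)) * ennreal (normal_density (- \<rho>) \<sigma> x)"
        using normal_density_exp_tilt[OF \<sigma>, of a x] a\<sigma> by (simp flip: ennreal_mult)
      then show "ennreal (normal_density 0 \<sigma> x) * (ennreal (exp (- a * x)) * indicator B x)
          = ennreal (exp (a\<^sup>2 * \<sigma>\<^sup>2 / 2)) * (ennreal (normal_density (- \<rho>) \<sigma> x) * indicator B x)"
        by (metis mult.assoc mult.commute)
    qed
    also have "\<dots> = ennreal (exp (a\<^sup>2 * \<sigma>\<^sup>2 / 2)) * emeasure (density lborel (normal_density (- \<rho>) \<sigma>)) B"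
      by (simp add: nn_integral_cmult emeasure_density)
    finally show ?thesis by (simp add: mult_ac)
  qed
  interpret N: prob_space "density lborel (normal_density (- \<rho>) \<sigma>)"
    by (rule prob_space_normal_density[OF \<sigma>])
  have one: "ennreal (exp (a\<^sup>2 * \<sigma>\<^sup>2 / 2)) * D = 1"
    using tilt[of UNIV] N.emeasure_space_1 norm by simp
  show ?thesis
  proof (rule measure_eqI)
    fix B assume "B \<in> sets (distr (density M (\<lambda>\<omega>. exp (- I \<omega> - c))) borel X)"
    then have [measurable]: "B \<in> sets borel" by simp
    have "emeasure (distr (density M (\<lambda>\<omega>. exp (- I \<omega> - c))) borel X) B
        = (\<integral>\<^sup>+\<omega>. ennreal (exp (- I \<omega> - c)) * indicator (X -` B \<inter> space M) \<omega> \<partial>M)"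
      by (simp add: emeasure_distr emeasure_density)
    also have "\<dots> = (\<integral>\<^sup>+\<omega>. ennreal (exp (- I \<omega> - c)) * indicator B (X \<omega>) \<partial>M)"
      by (intro nn_integral_cong) (auto simp: indicator_def)
    finally show "emeasure (distr (density M (\<lambda>\<omega>. exp (- I \<omega> - c))) borel X) B
        = emeasure (density lborel (normal_density (- \<rho>) \<sigma>)) B"
      by (simp add: tilt one)
  qed simp
qed

section \<open>Completed filtration\<close>

lemma space_completed_filtration[simp]: "space (completed_filtration M W t) = space M"
  by (simp add: completed_filtration_def space_measure_of_conv)

lemma sets_completed_filtration:
  "sets (completed_filtration M W t) = sigma_sets (space M) (past_events M W t \<union> null_sets M)"
proof -
  have "past_events M W t \<union> null_sets M \<subseteq> Pow (space M)"
    using sets.sets_into_space by (force simp: past_events_def null_sets_def)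
  then show ?thesis by (simp add: completed_filtration_def)
qed

lemma sets_completed_filtration_subset:
  assumes "\<And>s. 0 \<le> s \<Longrightarrow> s \<le> t \<Longrightarrow> W s \<in> borel_measurable M"
  shows "sets (completed_filtration M W t) \<subseteq> sets M"
  unfolding sets_completed_filtration
  by (intro sets.sigma_sets_subset) (use assms in \<open>auto simp: past_events_def\<close>)

lemma null_sets_subset_completed_filtration: "null_sets M \<subseteq> sets (completed_filtration M W t)"
  by (auto simp: sets_completed_filtration)

lemma measurable_completed_filtration:
  assumes "0 \<le> s" "s \<le> t"
  shows "W s \<in> borel_measurable (completed_filtration M W t)"
proof (rule measurableI)
  fix B :: "'b set" assume "B \<in> sets borel"
  then have "W s -` B \<inter> space M \<in> past_events M W t"
    using assms by (auto simp: past_events_def)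
  then show "W s -` B \<inter> space (completed_filtration M W t) \<in> sets (completed_filtration M W t)"
    by (simp add: sets_completed_filtration)
qed simp

text \<open>The preimages under \<open>X\<close> and \<open>X'\<close> agree off a null set
  \<open>Z\<close>; the part inside \<open>Z\<close> is itself a null set of \<open>M\<close> and
  hence belongs to \<open>F\<close>.\<close>

lemma measurable_AE_cong_null_sets:
  assumes X[measurable]: "X \<in> measurable M N" and X'[measurable]: "X' \<in> measurable F N"
    and F: "space F = space M" "sets F \<subseteq> sets M" "null_sets M \<subseteq> sets F"
    and AE: "AE \<omega> in M. X \<omega> = X' \<omega>"
  shows "X \<in> measurable F N"
proof (rule measurableI)
  fix B assume B[measurable]: "B \<in> sets N"
  obtain Z where Z: "Z \<in> null_sets M" "\<And>\<omega>. \<omega> \<in> space M \<Longrightarrow> X \<omega> \<noteq> X' \<omega> \<Longrightarrow> \<omega> \<in> Z"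
    using AE by (auto simp: eventually_ae_filter)
  have "X -` B \<inter> space M \<inter> Z \<in> null_sets M" using Z(1) by (intro null_set_Int1) auto
  then have 1: "X -` B \<inter> space M \<inter> Z \<in> sets F" using F by auto
  have 2: "X' -` B \<inter> space F \<in> sets F" "Z \<in> sets F" using measurable_sets[OF X' B] Z F by auto
  have "X \<omega> = X' \<omega>" if "\<omega> \<in> space M" "\<omega> \<notin> Z" for \<omega>
    using Z(2) that by blast
  then have "X -` B \<inter> space F = (X' -` B \<inter> space F - Z) \<union> (X -` B \<inter> space M \<inter> Z)"
    using F(1) by auto
  then show "X -` B \<inter> space F \<in> sets F" using 1 2 by auto
qed (use measurable_space[OF X] F(1) in simp)

text \<open>A subsequence of the step integrals converges almost surely, each of them is measurable
  for the filtration at time \<open>t\<close>, and the completion absorbs the exceptional set. This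
  lets a density given on that sigma-algebra only be applied to \<open>X\<close>.\<close>

lemma measurable_wiener_integral:
  fixes W :: "real \<Rightarrow> 'a \<Rightarrow> 'v::euclidean_space"
  assumes W: "\<And>s. 0 \<le> s \<Longrightarrow> s \<le> t \<Longrightarrow> W s \<in> borel_measurable M"
    and X: "has_wiener_integral M W t f X"
  shows "X \<in> borel_measurable (completed_filtration M W t)"
proof -
  let ?F = "completed_filtration M W t"
  obtain ps where ps: "\<And>k. \<forall>(a, b, c)\<in>set (ps k). 0 \<le> a \<and> a \<le> b \<and> b \<le> t"
    and lim: "(\<lambda>k. \<integral>\<^sup>+\<omega>. ennreal ((X \<omega> - step_integral W (ps k) \<omega>)\<^sup>2) \<partial>M) \<longlonglongrightarrow> 0"
    and X[measurable]: "X \<in> borel_measurable M"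
    using X unfolding has_wiener_integral_def by blast
  let ?J = "\<lambda>k. step_integral W (ps k)"
  have J[measurable]: "?J k \<in> borel_measurable M" for k
    by (rule measurable_step_integral[OF W ps])
  have JF[measurable]: "?J k \<in> borel_measurable ?F" for k
    by (rule measurable_step_integral[OF measurable_completed_filtration ps])
  \<comment> \<open>Finitely many initial distances may be infinite; from \<open>N\<close> on they
    are below 1, which makes every \<open>u k\<close> integrable, as the subsequence theorem
    requires.\<close>
  have "\<forall>\<^sub>F k in sequentially. (\<integral>\<^sup>+\<omega>. ennreal ((X \<omega> - ?J k \<omega>)\<^sup>2) \<partial>M) < 1"
    using order_tendstoD(2)[OF lim, of 1] by simp
  then obtain N where N: "\<And>k. N \<le> k \<Longrightarrow> (\<integral>\<^sup>+\<omega>. ennreal ((X \<omega> - ?J k \<omega>)\<^sup>2) \<partial>M) < 1"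
    unfolding eventually_sequentially by blast
  define u where "u k \<omega> = (X \<omega> - ?J (k + N) \<omega>)\<^sup>2" for k \<omega>
  have u: "integrable M (u k)" for k
  proof (rule integrableI_nonneg)
    show "(\<integral>\<^sup>+\<omega>. ennreal (u k \<omega>) \<partial>M) < \<infinity>"
      unfolding u_def using N[of "k + N"] by (auto intro: less_trans)
  qed (auto simp: u_def[abs_def])
  have "(\<lambda>k. ennreal (LINT \<omega>|M. norm (u k \<omega>))) \<longlonglongrightarrow> 0"
  proof -
    have "ennreal (LINT \<omega>|M. norm (u k \<omega>)) = (\<integral>\<^sup>+\<omega>. ennreal ((X \<omega> - ?J (k + N) \<omega>)\<^sup>2) \<partial>M)" for k
      using nn_integral_eq_integral[OF u[of k]] by (simp add: u_def[abs_def])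
    then show ?thesis using LIMSEQ_ignore_initial_segment[OF lim, of N] by simp
  qed
  then have "(\<lambda>k. LINT \<omega>|M. norm (u k \<omega>)) \<longlonglongrightarrow> 0"
    by (simp add: ennreal_0[symmetric] del: ennreal_0)
  then obtain r :: "nat \<Rightarrow> nat" where r: "AE \<omega> in M. (\<lambda>k. u (r k) \<omega>) \<longlonglongrightarrow> 0"
    using tendsto_L1_AE_subseq[of M u, OF u] by blast
  have "AE \<omega> in M. X \<omega> = lim (\<lambda>k. ?J (r k + N) \<omega>)"
    using r
  proof eventually_elim
    case (elim \<omega>)
    then have "(\<lambda>k. \<bar>X \<omega> - ?J (r k + N) \<omega>\<bar>) \<longlonglongrightarrow> 0"
      using tendsto_real_sqrt[OF elim] by (simp add: u_def)
    then have "(\<lambda>k. X \<omega> - (X \<omega> - ?J (r k + N) \<omega>)) \<longlonglongrightarrow> X \<omega> - 0"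
      by (intro tendsto_intros) (simp add: tendsto_rabs_zero_iff)
    then show ?case by (simp add: limI)
  qed
  note AE = this
  have "(\<lambda>\<omega>. lim (\<lambda>k. ?J (r k + N) \<omega>)) \<in> borel_measurable ?F"
    by (rule borel_measurable_lim_metric) (rule JF)
  then show ?thesis
    by (rule measurable_AE_cong_null_sets[OF X _ space_completed_filtration
          sets_completed_filtration_subset[OF W] null_sets_subset_completed_filtration AE])
qed

text \<open>\<open>W 0\<close> is almost surely 0, so a generating event is co-null or null
  according to whether its Borel set contains 0; this alternative is stable under complements and
  countable unions.\<close>

lemma completed_filtration_0_trivial:
  fixes W :: "real \<Rightarrow> 'a \<Rightarrow> 'v::euclidean_space"
  assumes W[measurable]: "W 0 \<in> borel_measurable M" and W0: "AE \<omega> in M. W 0 \<omega> = 0"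
    and A: "A \<in> sets (completed_filtration M W 0)"
  shows "A \<in> null_sets M \<or> space M - A \<in> null_sets M"
  using A unfolding sets_completed_filtration
proof induction
  case (Basic A)
  then consider B where "A = W 0 -` B \<inter> space M" "B \<in> sets borel" | "A \<in> null_sets M"
    by (auto simp: past_events_def)
  then show ?case
  proof cases
    case 1
    then have [measurable]: "A \<in> sets M" by simp
    show ?thesis
    proof (cases "0 \<in> B")
      case True
      have "AE \<omega> in M. \<omega> \<notin> space M - A"
        using W0 by eventually_elim (use 1 True in auto)
      then show ?thesis by (subst (asm) AE_iff_null_sets[symmetric]) auto
    next
      case False
      have "AE \<omega> in M. \<omega> \<notin> A"
        using W0 by eventually_elim (use 1 False in auto)
      then show ?thesis by (subst (asm) AE_iff_null_sets[symmetric]) auto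
    qed
  qed simp
next
  case Empty
  then show ?case by simp
next
  case (Compl A)
  then have "A \<in> sets M \<or> space M - A \<in> sets M" by auto
  moreover have "A \<subseteq> space M"
  proof -
    have "past_events M W 0 \<union> null_sets M \<subseteq> Pow (space M)"
      using sets.sets_into_space by (force simp: past_events_def null_sets_def)
    then show ?thesis using Compl.hyps by (rule sigma_sets_into_sp)
  qed
  ultimately show ?case using Compl.IH by (auto simp: double_diff)
next
  case (Union A)
  show ?case
  proof (cases "\<forall>i. A i \<in> null_sets M")
    case True
    then show ?thesis by (intro disjI1 null_sets_UN) auto
  next
    case False
    \<comment> \<open>One co-null member makes the whole union co-null.\<close>
    then obtain i where i: "space M - A i \<in> null_sets M" using Union.IH by blast
    have "\<Union>(range A) \<in> sets M"
    proof -
      have "sigma_sets (space M) (past_events M W 0 \<union> null_sets M) \<subseteq> sets M"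
        by (intro sets.sigma_sets_subset) (auto simp: past_events_def)
      then show ?thesis using Union.hyps by (auto intro!: sets.countable_UN)
    qed
    then have "space M - \<Union>(range A) \<in> null_sets M"
      by (intro null_sets_subset[OF i]) auto
    then show ?thesis by blast
  qed
qed

section \<open>Conditional expectation of parametrised functions\<close>

lemma (in prob_space) sigma_finite_subalgebra:
  assumes "subalgebra M F"
  shows "sigma_finite_subalgebra M F"
proof
  show "subalgebra M F" by fact
  interpret R: prob_space "restr_to_subalg M F"
  proof (rule prob_spaceI)
    have "space M \<in> sets F" using assms by (metis sets.top subalgebra_def)
    then show "emeasure (restr_to_subalg M F) (space (restr_to_subalg M F)) = 1"
      using assms emeasure_space_1 by (simp add: space_restr_to_subalg emeasure_restr_to_subalg)
  qed
  show "\<exists>A. countable A \<and> A \<subseteq> sets (restr_to_subalg M F) \<and> \<Union> A = space (restr_to_subalg M F) \<and>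
      (\<forall>a\<in>A. emeasure (restr_to_subalg M F) a \<noteq> \<infinity>)"
    by (rule R.sigma_finite_countable)
qed

context sigma_finite_subalgebra
begin

text \<open>Monotone convergence, tested on events of \<open>F\<close>. Conditional expectations
  increase only almost surely, hence the almost-everywhere form of the theorem.\<close>

lemma nn_cond_exp_SUP:
  assumes f[measurable]: "\<And>i::nat. f i \<in> borel_measurable M" and "incseq f"
  shows "AE x in M. (SUP i. nn_cond_exp M F (f i) x) = nn_cond_exp M F (\<lambda>x. SUP i. f i x) x"
proof (rule nn_cond_exp_charact)
  fix A assume A[measurable]: "A \<in> sets F"
  then have [measurable]: "A \<in> sets M" using subalg by (auto simp: subalgebra_def)
  have mono: "AE x in M. nn_cond_exp M F (f i) x \<le> nn_cond_exp M F (f (Suc i)) x" for i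
    by (rule nn_cond_exp_mono) (use \<open>incseq f\<close> in \<open>auto simp: incseq_def le_fun_def\<close>)
  have "(\<integral>\<^sup>+x\<in>A. (SUP i. f i x) \<partial>M) = (\<integral>\<^sup>+x. (SUP i. f i x * indicator A x) \<partial>M)"
    by (simp add: SUP_mult_right_ennreal)
  also have "\<dots> = (SUP i. \<integral>\<^sup>+x. f i x * indicator A x \<partial>M)"
    by (rule nn_integral_monotone_convergence_SUP)
       (use \<open>incseq f\<close> in \<open>auto simp: incseq_def le_fun_def intro!: mult_right_mono\<close>)
  also have "\<dots> = (SUP i. \<integral>\<^sup>+x. nn_cond_exp M F (f i) x * indicator A x \<partial>M)"
    using nn_cond_exp_intg[of "indicator A" "f _"] by (simp add: mult.commute)
  also have "\<dots> = (\<integral>\<^sup>+x. (SUP i. nn_cond_exp M F (f i) x * indicator A x) \<partial>M)"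
    by (rule nn_integral_monotone_convergence_SUP_AE[symmetric])
       (use mono in \<open>auto intro!: mult_right_mono intro: eventually_mono[OF mono]\<close>)
  also have "\<dots> = (\<integral>\<^sup>+x\<in>A. (SUP i. nn_cond_exp M F (f i) x) \<partial>M)"
    by (simp add: SUP_mult_right_ennreal)
  finally show "(\<integral>\<^sup>+x\<in>A. (SUP i. f i x) \<partial>M) = (\<integral>\<^sup>+x\<in>A. (SUP i. nn_cond_exp M F (f i) x) \<partial>M)" .
qed auto

end

text \<open>\<open>cond_call_price_version\<close> for an arbitrary parameter space and family, the
  generality that induction over measurable functions demands.\<close>

definition jointly_measurable_cond_exp where
  "jointly_measurable_cond_exp N M F X Y \<longleftrightarrow>
     (\<lambda>(T, \<omega>). Y T \<omega>) \<in> borel_measurable (N \<Otimes>\<^sub>M F) \<and>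
     (\<forall>T\<in>space N. AE \<omega> in M. Y T \<omega> = nn_cond_exp M F (X T) \<omega>)"

text \<open>Dynkin's argument from measurable rectangles: for \<open>B \<times> C\<close> the
  parameter factors out, and \<open>indicator B T\<close> times the conditional probability of
  \<open>C\<close> is a version. Complements and disjoint unions follow by subtracting from 1 and
  summing.\<close>

lemma (in prob_space) jointly_measurable_cond_exp_indicator:
  assumes F: "subalgebra M F" and A: "A \<in> sets (N \<Otimes>\<^sub>M M)"
  shows "\<exists>Y. jointly_measurable_cond_exp N M F (\<lambda>T \<omega>. indicator A (T, \<omega>)) Y"
  using A unfolding sets_pair_measure
proof (induction rule: sigma_sets_induct_disjoint[OF Int_stable_pair_measure_generator pair_measure_closed, consumes 1, case_names basic empty compl union])
  case (basic A)
  interpret sigma_finite_subalgebra M F by (rule sigma_finite_subalgebra[OF F])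
  from basic obtain B C where A: "A = B \<times> C" and [measurable]: "B \<in> sets N" "C \<in> sets M" by auto
  have "AE \<omega> in M. indicator B T * nn_cond_exp M F (indicator C) \<omega> = nn_cond_exp M F (\<lambda>\<omega>. indicator B T * indicator C \<omega>) \<omega>" for T
    by (rule nn_cond_exp_prod) auto
  then have "jointly_measurable_cond_exp N M F (\<lambda>T \<omega>. indicator A (T, \<omega>)) (\<lambda>T \<omega>. indicator B T * nn_cond_exp M F (indicator C) \<omega>)"
    unfolding jointly_measurable_cond_exp_def A by (auto simp: indicator_times)
  then show ?case by blast
next
  case empty
  interpret sigma_finite_subalgebra M F by (rule sigma_finite_subalgebra[OF F])
  have "AE \<omega> in M. 0 = nn_cond_exp M F (\<lambda>\<omega>. 0) \<omega>"
    by (rule nn_cond_exp_F_meas) auto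
  then have "jointly_measurable_cond_exp N M F (\<lambda>T \<omega>. indicator {} (T, \<omega>)) (\<lambda>T \<omega>. 0)"
    unfolding jointly_measurable_cond_exp_def by auto
  then show ?case by blast
next
  case (compl A)
  interpret sigma_finite_subalgebra M F by (rule sigma_finite_subalgebra[OF F])
  from compl obtain Y where Y: "jointly_measurable_cond_exp N M F (\<lambda>T \<omega>. indicator A (T, \<omega>)) Y" by blast
  have A[measurable]: "A \<in> sets (N \<Otimes>\<^sub>M M)" using compl by (simp add: sets_pair_measure)
  have [measurable]: "(\<lambda>(T, \<omega>). Y T \<omega>) \<in> borel_measurable (N \<Otimes>\<^sub>M F)"
    using Y by (simp add: jointly_measurable_cond_exp_def)
  have "AE \<omega> in M. 1 - Y T \<omega> = nn_cond_exp M F (\<lambda>\<omega>. indicator (space N \<times> space M - A) (T, \<omega>)) \<omega>" if T[measurable]: "T \<in> space N" for T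
  proof -
    let ?f = "\<lambda>\<omega>. indicator A (T, \<omega>) :: ennreal" and ?g = "\<lambda>\<omega>. indicator (space N \<times> space M - A) (T, \<omega>) :: ennreal"
    have [measurable]: "?f \<in> borel_measurable M" "?g \<in> borel_measurable M"
      by measurable
    have one: "AE \<omega> in M. 1 = nn_cond_exp M F (\<lambda>\<omega>. 1) \<omega>"
      by (rule nn_cond_exp_F_meas) auto
    have "AE \<omega> in M. nn_cond_exp M F (\<lambda>\<omega>. ?f \<omega> + ?g \<omega>) \<omega> = nn_cond_exp M F (\<lambda>\<omega>. 1) \<omega>"
      by (rule nn_cond_exp_cong) (use T in \<open>auto simp: indicator_def\<close>)
    moreover have "AE \<omega> in M. nn_cond_exp M F ?f \<omega> + nn_cond_exp M F ?g \<omega> = nn_cond_exp M F (\<lambda>\<omega>. ?f \<omega> + ?g \<omega>) \<omega>"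
      by (rule nn_cond_exp_sum) auto
    moreover have "AE \<omega> in M. Y T \<omega> = nn_cond_exp M F ?f \<omega>"
      using Y T by (simp add: jointly_measurable_cond_exp_def)
    ultimately show ?thesis using one
    proof eventually_elim
      case (elim \<omega>)
      \<comment> \<open>Cancellation in \<open>ennreal\<close> requires a finite summand, which the
        total 1 ensures.\<close>
      then have sum: "Y T \<omega> + nn_cond_exp M F ?g \<omega> = 1" by simp
      then have "Y T \<omega> \<noteq> \<top>" by auto
      then show ?case using sum by (metis ennreal_add_diff_cancel_left)
    qed
  qed
  then have "jointly_measurable_cond_exp N M F (\<lambda>T \<omega>. indicator (space N \<times> space M - A) (T, \<omega>)) (\<lambda>T \<omega>. 1 - Y T \<omega>)"
    unfolding jointly_measurable_cond_exp_def by auto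
  then show ?case by blast
next
  case (union A)
  interpret sigma_finite_subalgebra M F by (rule sigma_finite_subalgebra[OF F])
  from union obtain Y where Y: "\<And>i. jointly_measurable_cond_exp N M F (\<lambda>T \<omega>. indicator (A i) (T, \<omega>)) (Y i)" by metis
  have A[measurable]: "A i \<in> sets (N \<Otimes>\<^sub>M M)" for i using union by (auto simp: sets_pair_measure)
  have [measurable]: "(\<lambda>(T, \<omega>). Y i T \<omega>) \<in> borel_measurable (N \<Otimes>\<^sub>M F)" for i
    using Y by (simp add: jointly_measurable_cond_exp_def)
  have "AE \<omega> in M. (\<Sum>i. Y i T \<omega>) = nn_cond_exp M F (\<lambda>\<omega>. indicator (\<Union>i. A i) (T, \<omega>)) \<omega>" if T[measurable]: "T \<in> space N" for T
  proof (rule nn_cond_exp_charact)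
    have YF[measurable]: "Y i T \<in> borel_measurable F" for i by measurable
    have YM[measurable]: "Y i T \<in> borel_measurable M" for i using YF F measurable_from_subalg by blast
    show "(\<lambda>\<omega>. \<Sum>i. Y i T \<omega>) \<in> borel_measurable F" by measurable
    have "(\<Union>i. A i) \<in> sets (N \<Otimes>\<^sub>M M)" by auto
    then show "(\<lambda>\<omega>. indicator (\<Union>i. A i) (T, \<omega>) :: ennreal) \<in> borel_measurable M"
      by (intro measurable_compose[OF measurable_Pair1'[OF T] borel_measurable_indicator])
    fix B assume B[measurable]: "B \<in> sets F"
    then have [measurable]: "B \<in> sets M" using subalg by (auto simp: subalgebra_def)
    have "(\<integral>\<^sup>+\<omega>\<in>B. indicator (\<Union>i. A i) (T, \<omega>) \<partial>M) = (\<integral>\<^sup>+\<omega>. (\<Sum>i. indicator B \<omega> * indicator (A i) (T, \<omega>)) \<partial>M)"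
      using suminf_indicator[OF union(1)] by (simp add: mult.commute)
    also have "\<dots> = (\<Sum>i. \<integral>\<^sup>+\<omega>. indicator B \<omega> * indicator (A i) (T, \<omega>) \<partial>M)"
      by (rule nn_integral_suminf) measurable
    also have "\<dots> = (\<Sum>i. \<integral>\<^sup>+\<omega>. indicator B \<omega> * nn_cond_exp M F (\<lambda>\<omega>. indicator (A i) (T, \<omega>)) \<omega> \<partial>M)"
      by (subst nn_cond_exp_intg) auto
    also have "\<dots> = (\<Sum>i. \<integral>\<^sup>+\<omega>. indicator B \<omega> * Y i T \<omega> \<partial>M)"
    proof (intro arg_cong[where f=suminf] ext nn_integral_cong_AE)
      fix i
      have "AE \<omega> in M. Y i T \<omega> = nn_cond_exp M F (\<lambda>\<omega>. indicator (A i) (T, \<omega>)) \<omega>"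
        using Y T by (simp add: jointly_measurable_cond_exp_def)
      then show "AE \<omega> in M. indicator B \<omega> * nn_cond_exp M F (\<lambda>\<omega>. indicator (A i) (T, \<omega>)) \<omega> = indicator B \<omega> * Y i T \<omega>"
        by eventually_elim simp
    qed
    also have "\<dots> = (\<integral>\<^sup>+\<omega>. (\<Sum>i. indicator B \<omega> * Y i T \<omega>) \<partial>M)"
      by (rule nn_integral_suminf[symmetric]) measurable
    also have "\<dots> = (\<integral>\<^sup>+\<omega>\<in>B. (\<Sum>i. Y i T \<omega>) \<partial>M)" by (simp add: mult.commute)
    finally show "(\<integral>\<^sup>+\<omega>\<in>B. indicator (\<Union>i. A i) (T, \<omega>) \<partial>M) = (\<integral>\<^sup>+\<omega>\<in>B. (\<Sum>i. Y i T \<omega>) \<partial>M)" .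
  qed
  then have "jointly_measurable_cond_exp N M F (\<lambda>T \<omega>. indicator (\<Union>i. A i) (T, \<omega>)) (\<lambda>T \<omega>. \<Sum>i. Y i T \<omega>)"
    unfolding jointly_measurable_cond_exp_def by auto
  then show ?case by blast
qed

text \<open>Each operation that builds nonnegative measurable functions from indicators is repeated
  on the versions: it preserves joint measurability, and the almost sure identities are checked at
  each fixed \<open>T\<close>.\<close>

lemma (in prob_space) jointly_measurable_cond_exp_exists:
  assumes F: "subalgebra M F" and X: "X \<in> borel_measurable (N \<Otimes>\<^sub>M M)"
  shows "\<exists>Y. jointly_measurable_cond_exp N M F (\<lambda>T \<omega>. X (T, \<omega>)) Y"
  using X
proof (induction X rule: borel_measurable_induct)
  case (cong f g)
  then obtain Y where Y: "jointly_measurable_cond_exp N M F (\<lambda>T \<omega>. g (T, \<omega>)) Y" by blast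
  interpret sigma_finite_subalgebra M F by (rule sigma_finite_subalgebra[OF F])
  have [measurable]: "f \<in> borel_measurable (N \<Otimes>\<^sub>M M)" "g \<in> borel_measurable (N \<Otimes>\<^sub>M M)" by fact+
  have "AE \<omega> in M. nn_cond_exp M F (\<lambda>\<omega>. g (T, \<omega>)) \<omega> = nn_cond_exp M F (\<lambda>\<omega>. f (T, \<omega>)) \<omega>" if [measurable]: "T \<in> space N" for T
    by (rule nn_cond_exp_cong) (use cong(3) that in \<open>auto simp: space_pair_measure\<close>)
  with Y have "jointly_measurable_cond_exp N M F (\<lambda>T \<omega>. f (T, \<omega>)) Y"
    unfolding jointly_measurable_cond_exp_def by (fastforce elim: eventually_elim2)
  then show ?case by blast
next
  case (set A)
  then show ?case using jointly_measurable_cond_exp_indicator[OF F, of A N] by simp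
next
  case (mult u c)
  then obtain Y where Y: "jointly_measurable_cond_exp N M F (\<lambda>T \<omega>. u (T, \<omega>)) Y" by blast
  interpret sigma_finite_subalgebra M F by (rule sigma_finite_subalgebra[OF F])
  have [measurable]: "u \<in> borel_measurable (N \<Otimes>\<^sub>M M)" by fact
  have [measurable]: "(\<lambda>(T, \<omega>). Y T \<omega>) \<in> borel_measurable (N \<Otimes>\<^sub>M F)"
    using Y by (simp add: jointly_measurable_cond_exp_def)
  have "AE \<omega> in M. c * nn_cond_exp M F (\<lambda>\<omega>. u (T, \<omega>)) \<omega> = nn_cond_exp M F (\<lambda>\<omega>. c * u (T, \<omega>)) \<omega>" if [measurable]: "T \<in> space N" for T
    by (rule nn_cond_exp_prod) auto
  with Y have "jointly_measurable_cond_exp N M F (\<lambda>T \<omega>. c * u (T, \<omega>)) (\<lambda>T \<omega>. c * Y T \<omega>)"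
    unfolding jointly_measurable_cond_exp_def by (fastforce elim: eventually_elim2)
  then show ?case by blast
next
  case (add u v)
  then obtain Y Z where Y: "jointly_measurable_cond_exp N M F (\<lambda>T \<omega>. u (T, \<omega>)) Y"
    and Z: "jointly_measurable_cond_exp N M F (\<lambda>T \<omega>. v (T, \<omega>)) Z" by blast
  interpret sigma_finite_subalgebra M F by (rule sigma_finite_subalgebra[OF F])
  have [measurable]: "u \<in> borel_measurable (N \<Otimes>\<^sub>M M)" "v \<in> borel_measurable (N \<Otimes>\<^sub>M M)" by fact+
  have [measurable]: "(\<lambda>(T, \<omega>). Y T \<omega>) \<in> borel_measurable (N \<Otimes>\<^sub>M F)" "(\<lambda>(T, \<omega>). Z T \<omega>) \<in> borel_measurable (N \<Otimes>\<^sub>M F)"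
    using Y Z by (auto simp add: jointly_measurable_cond_exp_def)
  have "AE \<omega> in M. Y T \<omega> + Z T \<omega> = nn_cond_exp M F (\<lambda>\<omega>. v (T, \<omega>) + u (T, \<omega>)) \<omega>" if [measurable]: "T \<in> space N" for T
  proof -
    have "AE \<omega> in M. nn_cond_exp M F (\<lambda>\<omega>. v (T, \<omega>)) \<omega> + nn_cond_exp M F (\<lambda>\<omega>. u (T, \<omega>)) \<omega> = nn_cond_exp M F (\<lambda>\<omega>. v (T, \<omega>) + u (T, \<omega>)) \<omega>"
      by (rule nn_cond_exp_sum) auto
    moreover have "AE \<omega> in M. Y T \<omega> = nn_cond_exp M F (\<lambda>\<omega>. u (T, \<omega>)) \<omega>" "AE \<omega> in M. Z T \<omega> = nn_cond_exp M F (\<lambda>\<omega>. v (T, \<omega>)) \<omega>"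
      using Y Z that by (auto simp: jointly_measurable_cond_exp_def)
    ultimately show ?thesis by eventually_elim (simp add: add.commute)
  qed
  then have "jointly_measurable_cond_exp N M F (\<lambda>T \<omega>. v (T, \<omega>) + u (T, \<omega>)) (\<lambda>T \<omega>. Y T \<omega> + Z T \<omega>)"
    unfolding jointly_measurable_cond_exp_def by auto
  then show ?case by blast
next
  case (seq U)
  then obtain Y where Y: "\<And>i. jointly_measurable_cond_exp N M F (\<lambda>T \<omega>. U i (T, \<omega>)) (Y i)" by metis
  interpret sigma_finite_subalgebra M F by (rule sigma_finite_subalgebra[OF F])
  have [measurable]: "U i \<in> borel_measurable (N \<Otimes>\<^sub>M M)" for i by fact
  have [measurable]: "(\<lambda>(T, \<omega>). Y i T \<omega>) \<in> borel_measurable (N \<Otimes>\<^sub>M F)" for i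
    using Y by (simp add: jointly_measurable_cond_exp_def)
  have "AE \<omega> in M. (SUP i. Y i T \<omega>) = nn_cond_exp M F (\<lambda>\<omega>. SUP i. U i (T, \<omega>)) \<omega>" if [measurable]: "T \<in> space N" for T
  proof -
    have "AE \<omega> in M. (SUP i. nn_cond_exp M F (\<lambda>\<omega>. U i (T, \<omega>)) \<omega>) = nn_cond_exp M F (\<lambda>\<omega>. SUP i. U i (T, \<omega>)) \<omega>"
      by (rule nn_cond_exp_SUP) (use \<open>incseq U\<close> in \<open>auto simp: incseq_def le_fun_def\<close>)
    \<comment> \<open>The countably many exceptional sets are merged before passing to the
      supremum.\<close>
    moreover have "AE \<omega> in M. \<forall>i. Y i T \<omega> = nn_cond_exp M F (\<lambda>\<omega>. U i (T, \<omega>)) \<omega>"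
      using Y that by (auto simp: jointly_measurable_cond_exp_def AE_all_countable)
    ultimately show ?thesis by eventually_elim simp
  qed
  then have "jointly_measurable_cond_exp N M F (\<lambda>T \<omega>. (SUP i. U i) (T, \<omega>)) (\<lambda>T \<omega>. SUP i. Y i T \<omega>)"
    unfolding jointly_measurable_cond_exp_def by (auto simp: image_comp)
  then show ?case by blast
qed

text \<open>Against an event of \<open>F\<close>, Tonelli brings the integral over
  \<open>\<omega>\<close> inside, where the defining property of conditional expectation holds for
  each fixed \<open>T\<close>. The exceptional null set may therefore depend on
  \<open>T\<close>.\<close>

lemma (in prob_space) nn_cond_exp_nn_integral:
  assumes F: "subalgebra M F" and "sigma_finite_measure N"
    and X[measurable]: "(\<lambda>(T, \<omega>). X T \<omega>) \<in> borel_measurable (N \<Otimes>\<^sub>M M)"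
    and Y: "jointly_measurable_cond_exp N M F X Y"
  shows "AE \<omega> in M. (\<integral>\<^sup>+T. Y T \<omega> \<partial>N) = nn_cond_exp M F (\<lambda>\<omega>. \<integral>\<^sup>+T. X T \<omega> \<partial>N) \<omega>"
proof -
  interpret sigma_finite_subalgebra M F by (rule sigma_finite_subalgebra[OF F])
  interpret N: sigma_finite_measure N by fact
  interpret P: pair_sigma_finite N M ..
  have YF[measurable]: "(\<lambda>(T, \<omega>). Y T \<omega>) \<in> borel_measurable (N \<Otimes>\<^sub>M F)"
    using Y by (simp add: jointly_measurable_cond_exp_def)
  \<comment> \<open>\<open>F\<close> is coarser than \<open>M\<close>, so the identity is measurable
    from \<open>M\<close> to \<open>F\<close>; this yields the measurability of \<open>Y\<close> on
    \<open>N \<Otimes>\<^sub>M M\<close> that Tonelli uses.\<close>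
  have "id \<in> measurable M F" using F by (auto simp: subalgebra_def measurable_def)
  then have [measurable]: "(\<lambda>x. x) \<in> measurable M F" by (simp add: id_def)
  have "(\<lambda>(T, \<omega>). (T, \<omega>)) \<in> measurable (N \<Otimes>\<^sub>M M) (N \<Otimes>\<^sub>M F)" by measurable
  then have YM[measurable]: "(\<lambda>(T, \<omega>). Y T \<omega>) \<in> borel_measurable (N \<Otimes>\<^sub>M M)"
    using measurable_compose[OF _ YF] by (simp add: case_prod_unfold)
  show ?thesis
  proof (rule nn_cond_exp_charact)
    have "(\<lambda>(\<omega>, T). Y T \<omega>) \<in> borel_measurable (F \<Otimes>\<^sub>M N)" by measurable
    then show "(\<lambda>\<omega>. \<integral>\<^sup>+T. Y T \<omega> \<partial>N) \<in> borel_measurable F"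
      by (rule N.borel_measurable_nn_integral)
    show "(\<lambda>\<omega>. \<integral>\<^sup>+T. X T \<omega> \<partial>N) \<in> borel_measurable M" by measurable
    fix A assume [measurable]: "A \<in> sets F"
    then have [measurable]: "A \<in> sets M" using subalg by (auto simp: subalgebra_def)
    have "(\<integral>\<^sup>+\<omega>\<in>A. (\<integral>\<^sup>+T. X T \<omega> \<partial>N) \<partial>M) = (\<integral>\<^sup>+\<omega>. (\<integral>\<^sup>+T. indicator A \<omega> * X T \<omega> \<partial>N) \<partial>M)"
      by (intro nn_integral_cong) (auto simp: indicator_def)
    also have "\<dots> = (\<integral>\<^sup>+T. (\<integral>\<^sup>+\<omega>. indicator A \<omega> * X T \<omega> \<partial>M) \<partial>N)"
      by (rule P.Fubini') measurable
    also have "\<dots> = (\<integral>\<^sup>+T. (\<integral>\<^sup>+\<omega>. indicator A \<omega> * Y T \<omega> \<partial>M) \<partial>N)"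
    proof (rule nn_integral_cong)
      fix T assume T[measurable]: "T \<in> space N"
      have "(\<integral>\<^sup>+\<omega>. indicator A \<omega> * X T \<omega> \<partial>M) = (\<integral>\<^sup>+\<omega>. indicator A \<omega> * nn_cond_exp M F (X T) \<omega> \<partial>M)"
        by (rule nn_cond_exp_intg[symmetric]) measurable
      also have "\<dots> = (\<integral>\<^sup>+\<omega>. indicator A \<omega> * Y T \<omega> \<partial>M)"
      proof (rule nn_integral_cong_AE)
        have "AE \<omega> in M. Y T \<omega> = nn_cond_exp M F (X T) \<omega>"
          using Y T by (simp add: jointly_measurable_cond_exp_def)
        then show "AE \<omega> in M. indicator A \<omega> * nn_cond_exp M F (X T) \<omega> = indicator A \<omega> * Y T \<omega>"
          by eventually_elim simp
      qed
      finally show "(\<integral>\<^sup>+\<omega>. indicator A \<omega> * X T \<omega> \<partial>M) = (\<integral>\<^sup>+\<omega>. indicator A \<omega> * Y T \<omega> \<partial>M)" .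
    qed
    also have "\<dots> = (\<integral>\<^sup>+\<omega>. (\<integral>\<^sup>+T. indicator A \<omega> * Y T \<omega> \<partial>N) \<partial>M)"
      by (rule P.Fubini'[symmetric]) measurable
    also have "\<dots> = (\<integral>\<^sup>+\<omega>\<in>A. (\<integral>\<^sup>+T. Y T \<omega> \<partial>N) \<partial>M)"
      by (intro nn_integral_cong) (auto simp: indicator_def)
    finally show "(\<integral>\<^sup>+\<omega>\<in>A. (\<integral>\<^sup>+T. X T \<omega> \<partial>N) \<partial>M) = (\<integral>\<^sup>+\<omega>\<in>A. (\<integral>\<^sup>+T. Y T \<omega> \<partial>N) \<partial>M)" .
  qed
qed

text \<open>Over an event of probability 0 or 1, \<open>f\<close> and the constant have the same
  integral, so the constant has the characterising property.\<close>

lemma (in prob_space) nn_cond_exp_trivial: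
  assumes F: "subalgebra M F" and triv: "\<And>A. A \<in> sets F \<Longrightarrow> prob A = 0 \<or> prob A = 1"
    and f[measurable]: "f \<in> borel_measurable M"
  shows "AE \<omega> in M. nn_cond_exp M F f \<omega> = (\<integral>\<^sup>+\<omega>. f \<omega> \<partial>M)"
proof -
  interpret sigma_finite_subalgebra M F by (rule sigma_finite_subalgebra[OF F])
  have "AE \<omega> in M. (\<integral>\<^sup>+\<omega>. f \<omega> \<partial>M) = nn_cond_exp M F f \<omega>"
  proof (rule nn_cond_exp_charact)
    fix A assume A: "A \<in> sets F"
    then have AM[measurable]: "A \<in> sets M" using subalg by (auto simp: subalgebra_def)
    from triv[OF A] show "(\<integral>\<^sup>+\<omega>\<in>A. f \<omega> \<partial>M) = (\<integral>\<^sup>+\<omega>\<in>A. (\<integral>\<^sup>+\<omega>. f \<omega> \<partial>M) \<partial>M)"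
    proof
      assume "prob A = 0"
      then have "A \<in> null_sets M" by (simp add: null_sets_def emeasure_eq_measure)
      then show ?thesis by (simp add: nn_integral_null_set nn_integral_cmult_indicator null_setsD1)
    next
      assume 1: "prob A = 1"
      then have "AE \<omega> in M. \<omega> \<in> A" using AM by (simp add: prob_eq_1)
      then have "(\<integral>\<^sup>+\<omega>\<in>A. f \<omega> \<partial>M) = (\<integral>\<^sup>+\<omega>. f \<omega> \<partial>M)"
        by (intro nn_integral_cong_AE) (auto elim!: eventually_mono)
      then show ?thesis using 1 by (simp add: nn_integral_cmult_indicator emeasure_eq_measure)
    qed
  qed auto
  then show ?thesis by (auto elim!: eventually_mono)
qed

section \<open>Call prices under a normal law\<close>

text \<open>\<open>- std_normal_density\<close> is an antiderivative of the integrand and vanishes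
  at minus infinity.\<close>

lemma std_normal_tail_moment: 
  "(LINT x:{..d}|lborel. x * std_normal_density x) = - std_normal_density d"
proof -
  have int: "integrable lborel (\<lambda>x::real. x * std_normal_density x)"
    using integrable_std_normal_moment[of 1] by (simp add: mult.commute)
  have "(LBINT x=-\<infinity>..ereal d. x * std_normal_density x) = - std_normal_density d - 0"
  proof (rule interval_integral_FTC_integrable)
    show "((\<lambda>x. - std_normal_density x) has_vector_derivative x * std_normal_density x) (at x)" for x
      unfolding normal_density_def has_real_derivative_iff_has_vector_derivative[symmetric]
      by (auto intro!: derivative_eq_intros simp: field_simps)
    show "isCont (\<lambda>x. x * std_normal_density x) x" for x
      unfolding normal_density_def by (intro continuous_intros) auto
    show "set_integrable lborel (einterval (- \<infinity>) (ereal d)) (\<lambda>x. x * std_normal_density x)"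
      by (rule set_integrable_subset[where A=UNIV]) (use int in \<open>auto simp: set_integrable_def\<close>)
    have "((\<lambda>x. - std_normal_density x) \<longlongrightarrow> 0) at_bot"
      unfolding normal_density_def by simp real_asymp
    then show "(((\<lambda>x. - std_normal_density x) \<circ> real_of_ereal) \<longlongrightarrow> 0) (at_right (- \<infinity>))"
      by (simp add: ereal_tendsto_simps)
    have "((\<lambda>x. - std_normal_density x) \<longlongrightarrow> - std_normal_density d) (at_left d)"
      unfolding normal_density_def by (intro tendsto_intros) auto
    then show "(((\<lambda>x. - std_normal_density x) \<circ> real_of_ereal) \<longlongrightarrow> - std_normal_density d) (at_left (ereal d))"
      by (simp add: ereal_tendsto_simps)
  qed simp
  also have "(LBINT x=-\<infinity>..ereal d. x * std_normal_density x) = (LINT x:{..d}|lborel. x * std_normal_density x)"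
  proof -
    \<comment> \<open>The interval integral is over the open half-line; the endpoint is a null
      set.\<close>
    have "sym_diff {x. x < d} {..d} = {d}" by auto
    then show ?thesis
      unfolding interval_lebesgue_integral_def einterval_def
      using set_integral_null_delta[OF int, of "{x. x < d}" "{..d}"]
      by (simp add: countable_imp_null_set_lborel)
  qed
  finally show ?thesis by simp
qed

text \<open>On \<open>{..d}\<close> the payoff is \<open>d - x\<close>: its constant part integrates
  to \<open>d * std_normal_cdf d\<close>, its linear part to the tail moment. Nonnegativity is
  recorded since \<open>ennreal\<close> sends negative values to 0.\<close>

lemma
  shows std_normal_call_nonneg: "0 \<le> d * std_normal_cdf d + std_normal_density d"
    and nn_integral_call_std_normal: "(\<integral>\<^sup>+x. ennreal (max 0 (d - x)) * ennreal (std_normal_density x) \<partial>lborel)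
     = ennreal (d * std_normal_cdf d + std_normal_density d)"
proof -
  have int: "integrable lborel (\<lambda>x::real. x * std_normal_density x)"
    using integrable_std_normal_moment[of 1] by (simp add: mult.commute)
  have i1: "set_integrable lborel {..d} (\<lambda>x. d * std_normal_density x)"
    and i2: "set_integrable lborel {..d} (\<lambda>x. x * std_normal_density x)"
    by (rule set_integrable_subset[where A=UNIV]; use int in \<open>auto simp: set_integrable_def\<close>)+
  have eq: "(LINT x:{..d}|lborel. d * std_normal_density x - x * std_normal_density x)
      = d * std_normal_cdf d + std_normal_density d"
    by (simp add: set_integral_diff(2)[OF i1 i2] std_normal_tail_moment std_normal_cdf_def)
  have nonneg: "0 \<le> indicator {..d} x *\<^sub>R (d * std_normal_density x - x * std_normal_density x)" for x
    by (auto simp: indicator_def mult_right_mono)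
  show "0 \<le> d * std_normal_cdf d + std_normal_density d"
    unfolding eq[symmetric] set_lebesgue_integral_def by (rule Bochner_Integration.integral_nonneg[OF nonneg])
  have "(\<integral>\<^sup>+x. ennreal (max 0 (d - x)) * ennreal (std_normal_density x) \<partial>lborel)
     = (\<integral>\<^sup>+x. ennreal (indicator {..d} x *\<^sub>R (d * std_normal_density x - x * std_normal_density x)) \<partial>lborel)"
    by (intro nn_integral_cong)
       (auto simp: max_def indicator_def algebra_simps simp flip: ennreal_mult split: if_splits)
  also have "\<dots> = ennreal (LINT x:{..d}|lborel. d * std_normal_density x - x * std_normal_density x)"
    unfolding set_lebesgue_integral_def using set_integral_diff(1)[OF i1 i2] nonneg
    by (intro nn_integral_eq_integral) (auto simp: set_integrable_def)
  finally show "(\<integral>\<^sup>+x. ennreal (max 0 (d - x)) * ennreal (std_normal_density x) \<partial>lborel)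
     = ennreal (d * std_normal_cdf d + std_normal_density d)"
    unfolding eq .
qed

text \<open>Substituting \<open>\<mu> - \<sigma> * x\<close> standardises and reflects at once: the
  exercise region becomes \<open>{..d}\<close>, matching the left tail in
  \<open>std_normal_cdf\<close>, and a factor \<sigma> comes out of the payoff.\<close>

lemma nn_integral_call_normal:
  assumes \<sigma>: "0 < \<sigma>" and d: "d = (\<mu> - \<kappa>) / \<sigma>"
  shows "(\<integral>\<^sup>+x. ennreal (max 0 (x - \<kappa>)) \<partial>density lborel (normal_density \<mu> \<sigma>))
     = ennreal (\<sigma> * (d * std_normal_cdf d + std_normal_density d))"
proof -
  have *: "max 0 (\<mu> - \<sigma> * x - \<kappa>) = \<sigma> * max 0 (d - x)" for x
    using \<sigma> unfolding d by (auto simp: max_def field_simps)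
  have **: "\<sigma> * normal_density \<mu> \<sigma> (\<mu> - \<sigma> * x) = std_normal_density x" for x
    using \<sigma> by (simp add: normal_density_def power_mult_distrib real_sqrt_mult)
  have "(\<integral>\<^sup>+x. ennreal (max 0 (x - \<kappa>)) \<partial>density lborel (normal_density \<mu> \<sigma>))
     = (\<integral>\<^sup>+x. ennreal (normal_density \<mu> \<sigma> x) * ennreal (max 0 (x - \<kappa>)) \<partial>lborel)"
    by (subst nn_integral_density) auto
  also have "\<dots> = ennreal \<bar>- \<sigma>\<bar> * (\<integral>\<^sup>+x. ennreal (normal_density \<mu> \<sigma> (\<mu> + (- \<sigma>) * x)) * ennreal (max 0 (\<mu> + (- \<sigma>) * x - \<kappa>)) \<partial>lborel)"
    using \<sigma> by (intro nn_integral_real_affine) auto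
  also have "\<dots> = (\<integral>\<^sup>+x. ennreal \<sigma> * (ennreal (normal_density \<mu> \<sigma> (\<mu> - \<sigma> * x)) * ennreal (\<sigma> * max 0 (d - x))) \<partial>lborel)"
    using \<sigma> by (simp add: nn_integral_cmult *)
  also have "\<dots> = (\<integral>\<^sup>+x. ennreal \<sigma> * (ennreal (max 0 (d - x)) * ennreal (std_normal_density x)) \<partial>lborel)"
    using \<sigma> by (intro nn_integral_cong) (simp only: **[symmetric] ennreal_mult' less_imp_le mult_ac)
  also have "\<dots> = ennreal (\<sigma> * (d * std_normal_cdf d + std_normal_density d))"
    using \<sigma> by (subst nn_integral_cmult) (simp_all only: nn_integral_call_std_normal ennreal_mult' less_imp_le, measurable)
  finally show ?thesis .
qed

section \<open>The Reliability Option\<close>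

lemma density_process_onD:
  assumes "density_process_on M F T Q Z" "0 \<le> t" "t \<le> T" "A \<in> sets (F t)"
  shows "emeasure Q A = (\<integral>\<^sup>+\<omega>\<in>A. ennreal (Z t \<omega>) \<partial>M)"
  using assms by (auto simp: density_process_on_def)

text \<open>\<open>Q\<close> and the exponentially tilted \<open>M\<close> agree on the filtration
  at time \<open>t\<close>, where \<open>X\<close> is measurable, so they give \<open>X\<close> the
  same law. As in Girsanov's theorem, the mean moves by minus the covariance of \<open>X\<close> and
  \<open>I t\<close>.\<close>

lemma law_wiener_integral_under_Q:
  fixes W :: "real \<Rightarrow> 'a \<Rightarrow> real ^ 'n"
  assumes BM: "brownian_motion_on M Tbar W" and t: "0 \<le> t" "t \<le> Tbar"
    and f: "square_integrable_on {0..t} f" and \<theta>: "square_integrable_on {0..t} \<theta>"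
    and X: "has_wiener_integral M W t f X" and I: "has_wiener_integral M W t \<theta> (I t)"
    and Q: "prob_space Q" "sets Q = sets M"
    and dens: "density_process_on M (completed_filtration M W) Tbar Q
          (\<lambda>t \<omega>. exp (- I t \<omega> - 1 / 2 * (LINT s:{0..t}|lborel. (norm (\<theta> s))\<^sup>2)))"
    and pos: "0 < (LINT s:{0..t}|lborel. (norm (f s))\<^sup>2)"
  shows "distr Q borel X = density lborel
    (normal_density (- (LINT s:{0..t}|lborel. f s \<bullet> \<theta> s)) (sqrt (LINT s:{0..t}|lborel. (norm (f s))\<^sup>2)))"
proof -
  interpret prob_space M using BM by (rule brownian_motion_onD)
  interpret Q: prob_space Q by fact
  have W: "W s \<in> borel_measurable M" if "0 \<le> s" "s \<le> t" for s
    using brownian_motion_onD(2)[OF BM, of s] that t by auto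
  let ?F = "completed_filtration M W t"
  let ?c = "1 / 2 * (LINT s:{0..t}|lborel. (norm (\<theta> s))\<^sup>2)"
  let ?\<sigma>2 = "LINT s:{0..t}|lborel. (norm (f s))\<^sup>2" and ?\<rho> = "LINT s:{0..t}|lborel. f s \<bullet> \<theta> s"
    and ?\<tau> = "LINT s:{0..t}|lborel. (norm (\<theta> s))\<^sup>2"
  have [measurable]: "X \<in> borel_measurable M" "I t \<in> borel_measurable M"
    using X I by (auto simp: has_wiener_integral_def)
  have sp: "space Q = space M" by (rule sets_eq_imp_space_eq[OF Q(2)])
  have [measurable]: "X \<in> borel_measurable Q"
    by (simp cong: measurable_cong_sets[OF Q(2) refl])
  have XF: "X \<in> borel_measurable ?F" by (rule measurable_wiener_integral[OF W X])
  have Q_F: "emeasure Q A = (\<integral>\<^sup>+\<omega>\<in>A. ennreal (exp (- I t \<omega> - ?c)) \<partial>M)" if "A \<in> sets ?F" for A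
    by (rule density_process_onD[OF dens t that])
  have "distr Q borel X = distr (density M (\<lambda>\<omega>. exp (- I t \<omega> - ?c))) borel X"
  proof (rule measure_eqI)
    fix B assume "B \<in> sets (distr Q borel X)"
    then have B[measurable]: "B \<in> sets borel" by simp
    have "X -` B \<inter> space M \<in> sets ?F" using measurable_sets[OF XF B] by simp
    then show "emeasure (distr Q borel X) B = emeasure (distr (density M (\<lambda>\<omega>. exp (- I t \<omega> - ?c))) borel X) B"
      using Q_F by (simp add: emeasure_distr emeasure_density sp)
  qed simp
  also have "\<dots> = density lborel (normal_density (- ?\<rho>) (sqrt ?\<sigma>2))"
  proof (rule gaussian_exp_tilt)
    \<comment> \<open>Cramer-Wold: the joint characteristic function is that of a single Wiener
      integral, evaluated at 1.\<close>
    show "(LINT \<omega>|M. iexp (u * X \<omega> + v * I t \<omega>)) = exp (- (u\<^sup>2 * (sqrt ?\<sigma>2)\<^sup>2 + 2 * u * v * ?\<rho> + v\<^sup>2 * ?\<tau>) / 2)" for u v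
    proof -
      have A: "{0..t} \<in> sets borel" by simp
      have "(LINT \<omega>|M. iexp (u * X \<omega> + v * I t \<omega>)) = char (distr M borel (\<lambda>\<omega>. u * X \<omega> + v * I t \<omega>)) 1"
        by (simp add: char_def integral_distr)
      also have "\<dots> = exp (- 1\<^sup>2 * (LINT s:{0..t}|lborel. (norm (u *\<^sub>R f s + v *\<^sub>R \<theta> s))\<^sup>2) / 2)"
        by (rule char_wiener_integral[OF BM t square_integrable_on_linear(1)[OF f \<theta> A] has_wiener_integral_linear[OF W f \<theta> X I]])
      finally show ?thesis
        using pos unfolding square_integrable_on_linear(2)[OF f \<theta> A] by simp
    qed
    \<comment> \<open>The normalisation of the density is read off from \<open>Q\<close> having
      total mass 1.\<close>
    have "space M \<in> sets ?F" using sets.top[of ?F] by simp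
    from Q_F[OF this] show "(\<integral>\<^sup>+\<omega>. ennreal (exp (- I t \<omega> - ?c)) \<partial>M) = 1"
      using Q.emeasure_space_1 by (simp add: sp cong: nn_integral_cong)
  qed (use pos in auto)
  finally show ?thesis .
qed

text \<open>The iterated form of the price depends on versions, hence existence of a jointly
  measurable one together with independence of the choice. The closed formula holds in
  \<open>[0, \<infinity>]\<close>; its real form is conditional because the Lebesgue integral of a
  non-integrable function is 0 by convention.\<close>

theorem proposition30:
  fixes M Q :: "'a measure"
    and W :: "real \<Rightarrow> 'a \<Rightarrow> real ^ 'n"
    and K :: "real \<Rightarrow> real \<Rightarrow> real ^ 'n"
    and \<theta> :: "real \<Rightarrow> real ^ 'n"
    and \<phi> :: "real \<Rightarrow> real"
    and S I :: "real \<Rightarrow> 'a \<Rightarrow> real"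
    and Tbar T1 T2 \<kappa> :: real
  defines "F \<equiv> completed_filtration M W"
  defines "\<sigma> \<equiv> spot_sd K"
  defines "d \<equiv> ro_d \<phi> K \<theta> \<kappa>"
  assumes BM: "brownian_motion_on M Tbar W"
    and \<phi>: "continuous_on {0..Tbar} \<phi>"
    and K: "\<And>t. t \<in> {0..Tbar} \<Longrightarrow> square_integrable_on {0..t} (K t)"
    and S_meas: "(\<lambda>(t, \<omega>). S t \<omega>) \<in> borel_measurable (restrict_space borel {0..Tbar} \<Otimes>\<^sub>M M)"
    and S: "\<And>t. t \<in> {0..Tbar} \<Longrightarrow> has_wiener_integral M W t (K t) (\<lambda>\<omega>. S t \<omega> - \<phi> t)"
    and \<theta>: "square_integrable_on {0..Tbar} \<theta>"
    and I: "\<And>t. t \<in> {0..Tbar} \<Longrightarrow> has_wiener_integral M W t \<theta> (I t)"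
    and Q: "prob_space Q" "equivalent_measures M Q"
    and Q_density: "density_process_on M F Tbar Q
          (\<lambda>t \<omega>. exp (- I t \<omega> - 1 / 2 * (LINT s:{0..t}|lborel. (norm (\<theta> s))\<^sup>2)))"
    and times: "0 \<le> T1" "T1 < T2" "T2 \<le> Tbar"
    and \<sigma>_pos: "AE T in lborel. T \<in> {T1..T2} \<longrightarrow> \<sigma> T > 0"
  shows "(\<forall>t\<in>{0..Tbar}.
           (\<exists>Y. cond_call_price_version Q F S \<kappa> T1 T2 t Y) \<and>
           (\<forall>Y. cond_call_price_version Q F S \<kappa> T1 T2 t Y \<longrightarrow>
              (AE \<omega> in Q. reliability_option Q F S \<kappa> T1 T2 t \<omega> = (\<integral>\<^sup>+T\<in>{T1..T2}. Y T \<omega> \<partial>lborel))))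
    \<and> (AE \<omega> in Q. reliability_option Q F S \<kappa> T1 T2 0 \<omega> =
         (\<integral>\<^sup>+T\<in>{T1..T2}. ennreal (\<sigma> T * (d T * std_normal_cdf (d T) + std_normal_density (d T))) \<partial>lborel))
    \<and> (set_integrable lborel {T1..T2} (\<lambda>T. \<sigma> T * (d T * std_normal_cdf (d T) + std_normal_density (d T))) \<longrightarrow>
         (AE \<omega> in Q. reliability_option Q F S \<kappa> T1 T2 0 \<omega> =
           ennreal (LINT T:{T1..T2}|lborel. \<sigma> T * (d T * std_normal_cdf (d T) + std_normal_density (d T)))))"
proof -
  interpret P: prob_space M using BM by (rule brownian_motion_onD)
  interpret Q: prob_space Q by fact
  have sets_Q[measurable_cong, simp]: "sets Q = sets M" and null_Q: "null_sets Q = null_sets M"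
    using Q(2) by (auto simp: equivalent_measures_def)
  have sp: "space Q = space M" by (rule sets_eq_imp_space_eq[OF sets_Q])
  \<comment> \<open>Maturities as a sigma-finite measure space, with the same measurable sets as the
    Borel space in \<open>cond_call_price_version\<close>.\<close>
  define N where "N = restrict_space lborel {T1..T2}"
  have sets_N: "sets N = sets (restrict_space borel {T1..T2})"
    unfolding N_def by (intro sets_restrict_space_cong) simp
  have space_N: "space N = {T1..T2}" by (simp add: N_def space_restrict_space)
  have int_N: "(\<integral>\<^sup>+T. g T \<partial>N) = (\<integral>\<^sup>+T\<in>{T1..T2}. g T \<partial>lborel)" for g :: "real \<Rightarrow> ennreal"
    unfolding N_def by (rule nn_integral_restrict_space) simp
  have sf_N: "sigma_finite_measure N"
    unfolding N_def by (rule sigma_finite_measure_restrict_space[OF sigma_finite_lborel]) simp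
  interpret N: sigma_finite_measure N by (rule sf_N)
  let ?call = "\<lambda>T \<omega>. ennreal (call_payoff S \<kappa> T \<omega>)"
  have call_meas[measurable]: "(\<lambda>(T, \<omega>). ?call T \<omega>) \<in> borel_measurable (N \<Otimes>\<^sub>M Q)"
  proof -
    have "(\<lambda>T. T) \<in> measurable N (restrict_space borel {0..Tbar})"
      unfolding N_def using times
      by (intro measurable_restrict_space3) auto
    then have "(\<lambda>(T, \<omega>). (T, \<omega>)) \<in> measurable (N \<Otimes>\<^sub>M Q) (restrict_space borel {0..Tbar} \<Otimes>\<^sub>M M)"
      by measurable
    from measurable_compose[OF this S_meas]
    have [measurable]: "(\<lambda>(T, \<omega>). S T \<omega>) \<in> borel_measurable (N \<Otimes>\<^sub>M Q)"
      by (simp add: case_prod_unfold)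
    show ?thesis unfolding call_payoff_def by measurable
  qed
  have subalg: "subalgebra Q (F t)" if "t \<in> {0..Tbar}" for t
    unfolding subalgebra_def F_def using sets_completed_filtration_subset[of t W M] brownian_motion_onD(2)[OF BM] that
    by (simp add: sp)
  have version_iff: "cond_call_price_version Q F S \<kappa> T1 T2 t Y \<longleftrightarrow> jointly_measurable_cond_exp N Q (F t) ?call Y" for t Y
    unfolding cond_call_price_version_def jointly_measurable_cond_exp_def space_N
    by (simp cong: measurable_cong_sets[OF sets_pair_measure_cong[OF sets_N refl] refl])
  have ex: "\<exists>Y. cond_call_price_version Q F S \<kappa> T1 T2 t Y" if "t \<in> {0..Tbar}" for t
    unfolding version_iff using Q.jointly_measurable_cond_exp_exists[OF subalg[OF that] call_meas] by simp
  have version: "AE \<omega> in Q. reliability_option Q F S \<kappa> T1 T2 t \<omega> = (\<integral>\<^sup>+T\<in>{T1..T2}. Y T \<omega> \<partial>lborel)"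
    if "t \<in> {0..Tbar}" "cond_call_price_version Q F S \<kappa> T1 T2 t Y" for t Y
    using Q.nn_cond_exp_nn_integral[OF subalg[OF that(1)] sf_N call_meas that(2)[unfolded version_iff]]
    unfolding reliability_option_def int_N by eventually_elim simp
  let ?v = "\<lambda>T. \<sigma> T * (d T * std_normal_cdf (d T) + std_normal_density (d T))"
  have price: "(\<integral>\<^sup>+\<omega>. ?call T \<omega> \<partial>Q) = ennreal (?v T)" "0 \<le> ?v T" if T: "T \<in> {T1..T2}" and pos: "0 < \<sigma> T" for T
  proof -
    have T': "0 \<le> T" "T \<le> Tbar" and TT: "T \<in> {0..Tbar}" using T times by auto
    \<comment> \<open>The law at maturity \<open>T\<close> is computed with the density at time
      \<open>T\<close>, which involves \<theta> on \<open>{0..T}\<close> only.\<close>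
    have \<theta>T: "square_integrable_on {0..T} \<theta>"
      using \<theta> T' unfolding square_integrable_on_def
      by (auto intro: set_integrable_subset set_borel_measurable_subset)
    define X where "X \<omega> = S T \<omega> - \<phi> T" for \<omega>
    have X: "has_wiener_integral M W T (K T) X" using S[OF TT] by (simp add: X_def[abs_def])
    have [measurable]: "X \<in> borel_measurable M" using X by (simp add: has_wiener_integral_def)
    let ?\<rho> = "LINT s:{0..T}|lborel. K T s \<bullet> \<theta> s"
    have "distr Q borel X = density lborel (normal_density (- ?\<rho>) (\<sigma> T))"
      unfolding \<sigma>_def spot_sd_def
      by (rule law_wiener_integral_under_Q[OF BM T' K[OF TT] \<theta>T X I[OF TT] Q(1) sets_Q Q_density[unfolded F_def]])
         (use pos in \<open>simp add: \<sigma>_def spot_sd_def\<close>)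
    \<comment> \<open>Splitting off the deterministic part of the spot price moves
      \<open>\<phi> T\<close> into the strike.\<close>
    moreover have "(\<integral>\<^sup>+\<omega>. ?call T \<omega> \<partial>Q) = (\<integral>\<^sup>+x. ennreal (max 0 (x - (\<kappa> - \<phi> T))) \<partial>distr Q borel X)"
      by (subst nn_integral_distr) (auto simp: call_payoff_def X_def algebra_simps)
    moreover have "d T = (- ?\<rho> - (\<kappa> - \<phi> T)) / \<sigma> T"
      by (simp add: d_def ro_d_def spot_mean_Q_def \<sigma>_def)
    ultimately show "(\<integral>\<^sup>+\<omega>. ?call T \<omega> \<partial>Q) = ennreal (?v T)"
      using nn_integral_call_normal[OF pos] by simp
    show "0 \<le> ?v T" using pos std_normal_call_nonneg[of "d T"] by simp
  qed
  have price0: "AE \<omega> in Q. reliability_option Q F S \<kappa> T1 T2 0 \<omega> = (\<integral>\<^sup>+T\<in>{T1..T2}. ennreal (?v T) \<partial>lborel)"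
  proof -
    have 0: "0 \<in> {0..Tbar}" using times by simp
    \<comment> \<open>Equivalence of the measures transfers the null or co-null alternative from
      \<open>M\<close> to \<open>Q\<close>.\<close>
    have triv: "Q.prob A = 0 \<or> Q.prob A = 1" if A: "A \<in> sets (F 0)" for A
    proof -
      have AQ: "A \<in> sets Q" using subalg[OF 0] A by (auto simp: subalgebra_def)
      have "A \<in> null_sets Q \<or> space Q - A \<in> null_sets Q"
        unfolding null_Q sp using completed_filtration_0_trivial[of W M A] brownian_motion_onD[OF BM] A times
        by (simp add: F_def)
      then show ?thesis
        using Q.prob_compl[OF AQ] by (auto simp: null_sets_def Q.emeasure_eq_measure)
    qed
    interpret NQ: pair_sigma_finite N Q ..
    have call_int: "(\<lambda>\<omega>. \<integral>\<^sup>+T. ?call T \<omega> \<partial>N) \<in> borel_measurable Q"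
      by (rule N.borel_measurable_nn_integral)
         (use measurable_pair_swap[OF call_meas] in \<open>simp add: case_prod_unfold\<close>)
    have "AE \<omega> in Q. reliability_option Q F S \<kappa> T1 T2 0 \<omega> = (\<integral>\<^sup>+\<omega>. (\<integral>\<^sup>+T. ?call T \<omega> \<partial>N) \<partial>Q)"
      unfolding reliability_option_def int_N[symmetric]
      by (rule Q.nn_cond_exp_trivial[OF subalg[OF 0] triv call_int])
    also have "(\<integral>\<^sup>+\<omega>. (\<integral>\<^sup>+T. ?call T \<omega> \<partial>N) \<partial>Q) = (\<integral>\<^sup>+T. (\<integral>\<^sup>+\<omega>. ?call T \<omega> \<partial>Q) \<partial>N)"
      by (rule NQ.Fubini'[OF call_meas])
    \<comment> \<open>The call price is computed only where \<open>\<sigma> T > 0\<close>; the other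
      maturities in \<open>{T1..T2}\<close> form a Lebesgue null set.\<close>
    also have "\<dots> = (\<integral>\<^sup>+T\<in>{T1..T2}. ennreal (?v T) \<partial>lborel)"
      unfolding int_N using \<sigma>_pos
      by (intro nn_integral_cong_AE) (auto elim!: eventually_mono simp: indicator_def price)
    finally show ?thesis .
  qed
  have price0_real: "AE \<omega> in Q. reliability_option Q F S \<kappa> T1 T2 0 \<omega> = ennreal (LINT T:{T1..T2}|lborel. ?v T)"
    if int: "set_integrable lborel {T1..T2} ?v"
  proof -
    have "(\<integral>\<^sup>+T\<in>{T1..T2}. ennreal (?v T) \<partial>lborel) = (\<integral>\<^sup>+T. ennreal (indicator {T1..T2} T *\<^sub>R ?v T) \<partial>lborel)"
      by (intro nn_integral_cong) (auto simp: indicator_def)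
    also have "\<dots> = ennreal (LINT T:{T1..T2}|lborel. ?v T)"
      unfolding set_lebesgue_integral_def
    proof (rule nn_integral_eq_integral)
      show "AE T in lborel. 0 \<le> indicator {T1..T2} T *\<^sub>R ?v T"
        using \<sigma>_pos by eventually_elim (auto simp: indicator_def price(2))
    qed (use int in \<open>simp add: set_integrable_def\<close>)
    finally show ?thesis using price0 by simp
  qed
  show ?thesis using ex version price0 price0_real by blast
qed

end
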